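(* Let $A$ be a norm bounded subset of a Banach lattice $E$. The following statements are equivalent. (1) $A$ is disjointly weakly compact. (2) Every order bounded sequence $(f_n)\subset (E')^{+}$ satisfying $f_n\to 0$ in the weak$^*$ topology converges uniformly to zero on $A$. (3) Every disjoint $L$-sequence $(f_n)\subset E'$ converges uniformly to zero on $A$. (4) Every order bounded disjoint sequence $(f_n)\subset E'$ converges uniformly to zero on $A$.
   Context: All Banach spaces and Banach lattices are real. $E'$ is the norm dual of $E$ and $(E')^{+}$ its positive cone. A sequence $(x_n)$ in a Banach lattice is disjoint if $|x_n|\wedge|x_m|=0$ for $n\neq m$. The solid hull of a set $A\subset E$ is $Sol(A)=\{x\in E: |x|\le |a| \text{ for some } a\in A\}$. A norm bounded set $A\subset E$ is called disjointly weakly compact if every disjoint sequence $(x_n)\subset Sol(A)$ converges weakly to zero. A norm bounded set $B\subset X'$ ($X$ a Banach space) is an $L$-set if every weakly null sequence $(x_n)$ in $X$ converges to zero uniformly on $B$, i.e. $\sup_{f\in B}|f(x_n)|\to 0$. A sequence $(f_n)\subset X'$ is an $L$-sequence if the set $\{f_n:n\in\mathbb{N}\}$ is an $L$-set. A sequence $(f_n)\subset E'$ converges uniformly to zero on $A$ if $\sup_{x\in A}|f_n(x)|\to 0$. *)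

theory Defs
  imports "HOL-Analysis.Analysis" "HOL-Library.Lattice_Algebras"
begin

section \<open>Banach lattices\<close>

class banach_lattice = banach + ordered_real_vector + lattice_ab_group_add_abs +
  assumes norm_mono_abs: "\<bar>x\<bar> \<le> \<bar>y\<bar> \<Longrightarrow> norm x \<le> norm y"

instance real :: banach_lattice
  by standard simp

definition solid_hull :: "'a::banach_lattice set \<Rightarrow> 'a set" where
  "solid_hull A = {x. \<exists>a\<in>A. \<bar>x\<bar> \<le> \<bar>a\<bar>}"

definition disjoint_seq :: "(nat \<Rightarrow> 'a::banach_lattice) \<Rightarrow> bool" where
  "disjoint_seq x \<longleftrightarrow> (\<forall>n m. n \<noteq> m \<longrightarrow> inf \<bar>x n\<bar> \<bar>x m\<bar> = 0)"


section \<open>Weak and weak* topologies\<close>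

definition weak_topology :: "'a::real_normed_vector topology" where
  "weak_topology =
     pullback_topology UNIV (\<lambda>x (f :: 'a \<Rightarrow>\<^sub>L real). blinfun_apply f x) euclidean"

text \<open>On the dual, the library's strong operator topology (pointwise convergence of
  operators) is the weak* topology.\<close>

abbreviation weak_star_topology :: "('a::real_normed_vector \<Rightarrow>\<^sub>L real) topology" where
  "weak_star_topology \<equiv> strong_operator_topology"

definition weakly_null :: "(nat \<Rightarrow> 'a::real_normed_vector) \<Rightarrow> bool" where
  "weakly_null x \<longleftrightarrow> limitin weak_topology x 0 sequentially"

definition weak_star_null :: "(nat \<Rightarrow> 'a::real_normed_vector \<Rightarrow>\<^sub>L real) \<Rightarrow> bool" where
  "weak_star_null f \<longleftrightarrow> limitin weak_star_topology f 0 sequentially"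

lemma limitin_pullback_UNIV:
  fixes h :: "'a \<Rightarrow> 'b::topological_space"
  shows "limitin (pullback_topology UNIV h euclidean) x l F \<longleftrightarrow> ((\<lambda>n. h (x n)) \<longlongrightarrow> h l) F"
proof
  assume L: "limitin (pullback_topology UNIV h euclidean) x l F"
  show "((\<lambda>n. h (x n)) \<longlongrightarrow> h l) F"
  proof (rule topological_tendstoI)
    fix S :: "'b set" assume "open S" "h l \<in> S"
    then have "openin (pullback_topology UNIV h euclidean) (h -` S)" "l \<in> h -` S"
      by (auto simp: openin_pullback_topology)
    with L have "\<forall>\<^sub>F n in F. x n \<in> h -` S"
      unfolding limitin_def by blast
    then show "\<forall>\<^sub>F n in F. h (x n) \<in> S" by simp
  qed
next
  assume L: "((\<lambda>n. h (x n)) \<longlongrightarrow> h l) F"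
  show "limitin (pullback_topology UNIV h euclidean) x l F"
    unfolding limitin_def
  proof (intro conjI allI impI)
    show "l \<in> topspace (pullback_topology UNIV h euclidean)"
      by (simp add: topspace_pullback_topology)
    fix U assume "openin (pullback_topology UNIV h euclidean) U \<and> l \<in> U"
    then obtain S where "open S" "U = h -` S" "l \<in> U"
      by (auto simp: openin_pullback_topology)
    then show "\<forall>\<^sub>F n in F. x n \<in> U"
      using topological_tendstoD[OF L, of S] by simp
  qed
qed

lemma tendsto_fun_iff:
  fixes x :: "nat \<Rightarrow> 'a \<Rightarrow> 'b::topological_space"
  shows "(x \<longlonglongrightarrow> l) \<longleftrightarrow> (\<forall>i. (\<lambda>n. x n i) \<longlonglongrightarrow> l i)"
  using limitin_componentwise[of "\<lambda>_. euclidean" UNIV x l sequentially]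
  by (simp add: euclidean_product_topology)

lemma weakly_null_iff:
  "weakly_null x \<longleftrightarrow> (\<forall>f :: 'a::real_normed_vector \<Rightarrow>\<^sub>L real. (\<lambda>n. blinfun_apply f (x n)) \<longlonglongrightarrow> 0)"
  unfolding weakly_null_def weak_topology_def limitin_pullback_UNIV tendsto_fun_iff
  by (simp add: blinfun.zero_right)

lemma weak_star_null_iff:
  "weak_star_null f \<longleftrightarrow> (\<forall>x. (\<lambda>n. blinfun_apply (f n) x) \<longlonglongrightarrow> 0)"
  unfolding weak_star_null_def strong_operator_topology_def limitin_pullback_UNIV tendsto_fun_iff
  by simp


section \<open>The order dual structure of the norm dual\<close>

definition dual_le :: "('a::banach_lattice \<Rightarrow>\<^sub>L real) \<Rightarrow> ('a \<Rightarrow>\<^sub>L real) \<Rightarrow> bool" where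
  "dual_le f g \<longleftrightarrow> (\<forall>x\<ge>0. blinfun_apply f x \<le> blinfun_apply g x)"

definition dual_less :: "('a::banach_lattice \<Rightarrow>\<^sub>L real) \<Rightarrow> ('a \<Rightarrow>\<^sub>L real) \<Rightarrow> bool" where
  "dual_less f g \<longleftrightarrow> dual_le f g \<and> \<not> dual_le g f"

text \<open>The order-theoretic supremum and infimum of two functionals; they always exist,
  see \<open>dual_lattice\<close> below.\<close>

definition dual_sup :: "('a::banach_lattice \<Rightarrow>\<^sub>L real) \<Rightarrow> ('a \<Rightarrow>\<^sub>L real) \<Rightarrow> 'a \<Rightarrow>\<^sub>L real" where
  "dual_sup f g = (THE h. dual_le f h \<and> dual_le g h \<and>
     (\<forall>k. dual_le f k \<and> dual_le g k \<longrightarrow> dual_le h k))"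

definition dual_inf :: "('a::banach_lattice \<Rightarrow>\<^sub>L real) \<Rightarrow> ('a \<Rightarrow>\<^sub>L real) \<Rightarrow> 'a \<Rightarrow>\<^sub>L real" where
  "dual_inf f g = (THE h. dual_le h f \<and> dual_le h g \<and>
     (\<forall>k. dual_le k f \<and> dual_le k g \<longrightarrow> dual_le k h))"

definition dual_abs :: "('a::banach_lattice \<Rightarrow>\<^sub>L real) \<Rightarrow> 'a \<Rightarrow>\<^sub>L real" where
  "dual_abs f = dual_sup f (- f)"

definition dual_positive_cone :: "('a::banach_lattice \<Rightarrow>\<^sub>L real) set" where
  "dual_positive_cone = {f. dual_le 0 f}"

definition dual_order_bounded_seq :: "(nat \<Rightarrow> 'a::banach_lattice \<Rightarrow>\<^sub>L real) \<Rightarrow> bool" where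
  "dual_order_bounded_seq f \<longleftrightarrow> (\<exists>g h. \<forall>n. dual_le g (f n) \<and> dual_le (f n) h)"

definition dual_disjoint_seq :: "(nat \<Rightarrow> 'a::banach_lattice \<Rightarrow>\<^sub>L real) \<Rightarrow> bool" where
  "dual_disjoint_seq f \<longleftrightarrow>
     (\<forall>n m. n \<noteq> m \<longrightarrow> dual_inf (dual_abs (f n)) (dual_abs (f m)) = 0)"

subsection \<open>Existence of suprema and infima (Riesz--Kantorovich)\<close>

lemma banach_lattice_split:
  fixes x :: "'a::banach_lattice"
  shows "x = sup x 0 - sup (- x) 0"
proof -
  have "x = sup x 0 + inf x 0" using add_eq_inf_sup[of x 0] by simp
  also have "inf x 0 = - sup (- x) 0" using inf_eq_neg_sup[of x 0] by (simp only: minus_zero)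
  finally show ?thesis by (simp only: add_uminus_conv_diff)
qed

lemma abs_of_nonneg_lattice: "0 \<le> x \<Longrightarrow> \<bar>x\<bar> = x" for x :: "'a::banach_lattice"
  unfolding abs_lattice by (rule sup_absorb1) (simp add: order_trans[of "- x" 0 x])

lemma norm_pos_part_le: "norm (sup x 0) \<le> norm x" for x :: "'a::banach_lattice"
proof (rule norm_mono_abs)
  have "sup x 0 \<le> \<bar>x\<bar>" by (intro sup_least abs_ge_self abs_ge_zero)
  then show "\<bar>sup x 0\<bar> \<le> \<bar>x\<bar>" by (simp add: abs_of_nonneg_lattice)
qed

lemma dual_le_antisym:
  assumes "dual_le f g" "dual_le g f" shows "f = g"
proof (rule blinfun_eqI)
  fix x :: 'a
  have *: "blinfun_apply f y = blinfun_apply g y" if "0 \<le> y" for y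
    using assms that unfolding dual_le_def by (meson order.antisym)
  show "blinfun_apply f x = blinfun_apply g x"
    using *[of "sup x 0"] *[of "sup (- x) 0"]
    unfolding arg_cong[OF banach_lattice_split[of x], of "blinfun_apply f"]
      arg_cong[OF banach_lattice_split[of x], of "blinfun_apply g"] blinfun.diff_right
    by simp
qed

lemma dual_pos_part_exists:
  fixes f :: "'a::banach_lattice \<Rightarrow>\<^sub>L real"
  shows "\<exists>h. dual_le f h \<and> dual_le 0 h \<and> (\<forall>k. dual_le f k \<and> dual_le 0 k \<longrightarrow> dual_le h k)"
proof -
  define p where "p x = (SUP y\<in>{0..x}. blinfun_apply f y)" for x
  have fle: "blinfun_apply f y \<le> norm f * norm x" if "0 \<le> y" "y \<le> x" for x y
  proof -
    have "\<bar>y\<bar> \<le> \<bar>x\<bar>" using that by (simp only: abs_of_nonneg_lattice order_trans[OF that])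
    then have "norm y \<le> norm x" by (rule norm_mono_abs)
    then have "norm f * norm y \<le> norm f * norm x" by (simp add: mult_left_mono)
    then show ?thesis using norm_blinfun[of f y] by simp
  qed
  have bdd: "bdd_above (blinfun_apply f ` {0..x})" for x
    using fle by (intro bdd_aboveI[of _ "norm f * norm x"]) auto
  have p_upper: "blinfun_apply f y \<le> p x" if "0 \<le> y" "y \<le> x" for x y
    unfolding p_def using that by (intro cSUP_upper bdd) auto
  have p_least: "p x \<le> c" if "0 \<le> x" "\<And>y. 0 \<le> y \<Longrightarrow> y \<le> x \<Longrightarrow> blinfun_apply f y \<le> c" for x c
    unfolding p_def using that by (intro cSUP_least) auto
  have p_nonneg: "0 \<le> p x" if "0 \<le> x" for x
    using p_upper[of 0 x] that by (simp add: blinfun.zero_right)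
  have p_bound: "p x \<le> norm f * norm x" if "0 \<le> x" for x
    using that fle by (intro p_least)
  have p_add: "p (x + z) = p x + p z" if x: "0 \<le> x" and z: "0 \<le> z" for x z
  proof (rule order.antisym)
    show "p (x + z) \<le> p x + p z"
    proof (rule p_least)
      show "0 \<le> x + z" using x z by simp
      fix y assume y: "0 \<le> y" "y \<le> x + z"
      have e: "y - inf y x = sup 0 (y - x)"
        by (simp add: diff_inf_eq_sup add_sup_distrib_left)
      have "y - x \<le> z" using y by (simp add: algebra_simps)
      then have "sup 0 (y - x) \<le> z" using z by simp
      then have "blinfun_apply f (y - inf y x) \<le> p z"
        unfolding e by (intro p_upper) auto
      moreover have "blinfun_apply f (inf y x) \<le> p x"
        using y x by (intro p_upper) auto
      ultimately show "blinfun_apply f y \<le> p x + p z"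
        unfolding blinfun.diff_right by linarith
    qed
    have "p x \<le> p (x + z) - p z"
    proof (rule p_least[OF x])
      fix y assume y: "0 \<le> y" "y \<le> x"
      have "p z \<le> p (x + z) - blinfun_apply f y"
      proof (rule p_least[OF z])
        fix w assume "0 \<le> w" "w \<le> z"
        then have "blinfun_apply f (y + w) \<le> p (x + z)"
          using y by (intro p_upper) (auto intro: add_mono)
        then show "blinfun_apply f w \<le> p (x + z) - blinfun_apply f y"
          by (simp add: blinfun.add_right)
      qed
      then show "blinfun_apply f y \<le> p (x + z) - p z" by simp
    qed
    then show "p x + p z \<le> p (x + z)" by simp
  qed
  have p_scale_le: "p (c *\<^sub>R x) \<le> c * p x" if "0 \<le> x" "0 < c" for c x
  proof (rule p_least)
    show "0 \<le> c *\<^sub>R x" using that by (simp add: scaleR_nonneg_nonneg)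
    fix y assume y: "0 \<le> y" "y \<le> c *\<^sub>R x"
    have "inverse c *\<^sub>R y \<le> inverse c *\<^sub>R (c *\<^sub>R x)"
      using y that by (intro scaleR_left_mono) auto
    moreover have "0 \<le> inverse c *\<^sub>R y"
      using y that by (intro scaleR_nonneg_nonneg) auto
    ultimately have "blinfun_apply f (inverse c *\<^sub>R y) \<le> p x"
      using that by (intro p_upper) auto
    then show "blinfun_apply f y \<le> c * p x"
      using that by (simp add: blinfun.scaleR_right field_simps)
  qed
  have p_scale: "p (c *\<^sub>R x) = c * p x" if x: "0 \<le> x" and c: "0 < c" for c x
  proof (rule order.antisym[OF p_scale_le[OF x c]])
    have "p (inverse c *\<^sub>R (c *\<^sub>R x)) \<le> inverse c * p (c *\<^sub>R x)"
      using x c by (intro p_scale_le) (auto simp: scaleR_nonneg_nonneg)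
    then show "c * p x \<le> p (c *\<^sub>R x)" using c by (simp add: field_simps)
  qed
  define h where "h x = p (sup x 0) - p (sup (- x) 0)" for x
  have h_diff: "h x = p a - p b" if "x = a - b" "0 \<le> a" "0 \<le> b" for x a b
  proof -
    have "a + sup (- x) 0 = sup x 0 + b"
    proof -
      have "a - b = sup x 0 - sup (- x) 0"
        using banach_lattice_split[of x] that(1) by (rule trans[OF sym, rotated])
      moreover have "s - t = u - v \<Longrightarrow> s + v = u + t" for s t u v :: 'a
        by (simp add: diff_eq_eq add.commute add.left_commute)
      ultimately show ?thesis by blast
    qed
    then have "p a + p (sup (- x) 0) = p (sup x 0) + p b"
      using p_add[of a "sup (- x) 0"] p_add[of "sup x 0" b] that by simp
    then show ?thesis unfolding h_def by simp
  qed
  have p0: "p 0 = 0" using p_add[of 0 0] by simp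
  have h_pos: "h x = p x" if "0 \<le> x" for x
    using h_diff[of x x 0] that p0 by simp
  have h_add: "h (x + z) = h x + h z" for x z
  proof -
    have "x + z = (sup x 0 + sup z 0) - (sup (- x) 0 + sup (- z) 0)"
      unfolding add_diff_add banach_lattice_split[symmetric] by (rule refl)
    then have "h (x + z) = p (sup x 0 + sup z 0) - p (sup (- x) 0 + sup (- z) 0)"
      by (rule h_diff) simp_all
    then show ?thesis by (simp add: p_add h_def)
  qed
  have h_minus: "h (- x) = - h x" for x
    by (simp add: h_def)
  have h_scale_pos: "h (c *\<^sub>R x) = c * h x" if c: "0 < c" for c x
  proof -
    have "c *\<^sub>R x = c *\<^sub>R sup x 0 - c *\<^sub>R sup (- x) 0"
      unfolding scaleR_right_diff_distrib[symmetric] banach_lattice_split[symmetric] by (rule refl)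
    then have "h (c *\<^sub>R x) = p (c *\<^sub>R sup x 0) - p (c *\<^sub>R sup (- x) 0)"
      using c by (intro h_diff) (auto simp: scaleR_nonneg_nonneg)
    then show ?thesis using c by (simp add: p_scale h_def algebra_simps)
  qed
  have h_scale: "h (c *\<^sub>R x) = c *\<^sub>R h x" for c x
  proof -
    consider "c = 0" | "0 < c" | "0 < - c" by linarith
    then show ?thesis
    proof cases
      case 1 then show ?thesis using h_pos[of 0] p0 by simp
    next
      case 2 then show ?thesis by (simp add: h_scale_pos)
    next
      case 3 then show ?thesis using h_scale_pos[OF 3, of x] h_minus[of "c *\<^sub>R x"] by simp
    qed
  qed
  have h_bound: "norm (h x) \<le> norm x * norm f" for x
  proof -
    have "norm f * norm (sup x 0) \<le> norm f * norm x"
         "norm f * norm (sup (- x) 0) \<le> norm f * norm x"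
      using norm_pos_part_le[of x] norm_pos_part_le[of "- x"] by (auto intro: mult_left_mono)
    then have "p (sup x 0) \<le> norm f * norm x" "p (sup (- x) 0) \<le> norm f * norm x"
      using p_bound[of "sup x 0"] p_bound[of "sup (- x) 0"] by auto
    then show ?thesis
      unfolding h_def using p_nonneg[of "sup x 0"] p_nonneg[of "sup (- x) 0"]
      by (simp add: mult.commute abs_le_iff)
  qed
  have "bounded_linear h"
    by (rule bounded_linear_intro[OF h_add h_scale h_bound])
  then have app: "blinfun_apply (Blinfun h) = h" by (rule bounded_linear_Blinfun_apply)
  show ?thesis
  proof (intro exI[of _ "Blinfun h"] conjI allI impI)
    show "dual_le f (Blinfun h)"
      by (simp add: dual_le_def app h_pos p_upper)
    show "dual_le 0 (Blinfun h)"
      by (simp add: dual_le_def app h_pos p_nonneg)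
    fix k assume k: "dual_le f k \<and> dual_le 0 k"
    have "p x \<le> blinfun_apply k x" if "0 \<le> x" for x
    proof (rule p_least[OF that])
      fix y assume y: "0 \<le> y" "y \<le> x"
      then have "blinfun_apply f y \<le> blinfun_apply k y" "0 \<le> blinfun_apply k (x - y)"
        using k by (auto simp: dual_le_def)
      then show "blinfun_apply f y \<le> blinfun_apply k x" by (simp add: blinfun.diff_right)
    qed
    then show "dual_le (Blinfun h) k" by (simp add: dual_le_def app h_pos)
  qed
qed

lemma dual_sup_exists:
  fixes f g :: "'a::banach_lattice \<Rightarrow>\<^sub>L real"
  shows "\<exists>!h. dual_le f h \<and> dual_le g h \<and> (\<forall>k. dual_le f k \<and> dual_le g k \<longrightarrow> dual_le h k)"
proof -
  obtain h where h: "dual_le (f - g) h" "dual_le 0 h"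
    "\<And>k. dual_le (f - g) k \<Longrightarrow> dual_le 0 k \<Longrightarrow> dual_le h k"
    using dual_pos_part_exists[of "f - g"] by blast
  have "dual_le (h + g) k" if "dual_le f k" "dual_le g k" for k
    using h(3)[of "k - g"] that
    by (simp add: dual_le_def blinfun.diff_left blinfun.add_left algebra_simps)
  moreover have "dual_le f (h + g)" "dual_le g (h + g)"
    using h(1,2) by (simp_all add: dual_le_def blinfun.diff_left blinfun.add_left algebra_simps)
  ultimately show ?thesis
    by (intro ex1I[of _ "h + g"]) (auto intro: dual_le_antisym)
qed

lemma dual_inf_exists:
  fixes f g :: "'a::banach_lattice \<Rightarrow>\<^sub>L real"
  shows "\<exists>!h. dual_le h f \<and> dual_le h g \<and> (\<forall>k. dual_le k f \<and> dual_le k g \<longrightarrow> dual_le k h)"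
proof -
  have neg: "dual_le (- a) b \<longleftrightarrow> dual_le (- b) a" "dual_le a (- b) \<longleftrightarrow> dual_le b (- a)"
    for a b :: "'a \<Rightarrow>\<^sub>L real"
    unfolding dual_le_def blinfun.minus_left by (auto simp: minus_le_iff le_minus_iff)
  obtain h where h: "dual_le (- f) h" "dual_le (- g) h"
    "\<And>k. dual_le (- f) k \<Longrightarrow> dual_le (- g) k \<Longrightarrow> dual_le h k"
    using dual_sup_exists[of "- f" "- g"] by blast
  have "dual_le (- h) f" "dual_le (- h) g" using h(1,2) neg(1) by blast+
  moreover have "dual_le k (- h)" if "dual_le k f" "dual_le k g" for k
    using h(3)[of "- k"] that neg by (metis minus_minus)
  ultimately show ?thesis
    by (intro ex1I[of _ "- h"]) (auto intro: dual_le_antisym)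
qed

lemma dual_lattice: "class.lattice dual_inf dual_le dual_less dual_sup"
proof
  note S = theI'[OF dual_sup_exists, folded dual_sup_def]
  note I = theI'[OF dual_inf_exists, folded dual_inf_def]
  fix f g h :: "'a \<Rightarrow>\<^sub>L real"
  show "dual_less f g = (dual_le f g \<and> \<not> dual_le g f)" by (rule dual_less_def)
  show "dual_le f f" by (simp add: dual_le_def)
  show "dual_le f g \<Longrightarrow> dual_le g h \<Longrightarrow> dual_le f h"
    by (auto simp: dual_le_def intro: order_trans)
  show "dual_le f g \<Longrightarrow> dual_le g f \<Longrightarrow> f = g" by (rule dual_le_antisym)
  show "dual_le (dual_inf f g) f" "dual_le (dual_inf f g) g"
    "dual_le f g \<Longrightarrow> dual_le f h \<Longrightarrow> dual_le f (dual_inf g h)"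
    using I by blast+
  show "dual_le f (dual_sup f g)" "dual_le g (dual_sup f g)"
    "dual_le g f \<Longrightarrow> dual_le h f \<Longrightarrow> dual_le (dual_sup g h) f"
    using S by blast+
qed


section \<open>Disjointly weakly compact sets, L-sets and L-sequences\<close>

definition disjointly_weakly_compact :: "'a::banach_lattice set \<Rightarrow> bool" where
  "disjointly_weakly_compact A \<longleftrightarrow>
     bounded A \<and>
     (\<forall>x. range x \<subseteq> solid_hull A \<and> disjoint_seq x \<longrightarrow> weakly_null x)"

definition L_set :: "('a::banach \<Rightarrow>\<^sub>L real) set \<Rightarrow> bool" where
  "L_set B \<longleftrightarrow>
     bounded B \<and>
     (\<forall>x. weakly_null x \<longrightarrow>
        uniform_limit B (\<lambda>n f. blinfun_apply f (x n)) (\<lambda>_. 0) sequentially)"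

definition L_sequence :: "(nat \<Rightarrow> 'a::banach \<Rightarrow>\<^sub>L real) \<Rightarrow> bool" where
  "L_sequence f \<longleftrightarrow> L_set (range f)"

definition uniformly_null_on ::
  "'a::real_normed_vector set \<Rightarrow> (nat \<Rightarrow> 'a \<Rightarrow>\<^sub>L real) \<Rightarrow> bool" where
  "uniformly_null_on A f \<longleftrightarrow>
     uniform_limit A (\<lambda>n. blinfun_apply (f n)) (\<lambda>_. 0) sequentially"

end

(* The implications are (1) => (2) => (1), (4) => (1), (1) => (3), (3) => (4).

   If f_n >= 0 is norm bounded and weak* null and f_n(|a_n|) >= e with a_n in A, then along a
   subsequence the |a_n| dominate pairwise disjoint elements y_n with f_n(y_n) >= e/2; as the
   y_n lie in the solid hull of A, this gives (1) => (2), and (1) => (3) once the moduli of a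
   disjoint L-sequence are known to be weak* null.  That follows from a Rosenthal-type
   selection: if disjoint functionals p_n >= 0 satisfy p_n(x) >= e for a fixed x, a
   subsequence of them is almost carried by pairwise disjoint elements of [0, x].

   Conversely, if g >= e > 0 on a disjoint positive sequence in the solid hull of A, the
   components of g on the bands these elements generate are disjoint, positive, bounded by g
   and not uniformly small on A; they violate (2) and (4).  For (3) => (4), a disjoint order
   bounded sequence (f_n) maps E into l1 by x |-> (f_n(x)), and weakly null sequences of l1
   converge uniformly in the coordinates by the Schur property. *)

theory Submission
  imports Defs
begin

text \<open>Two obstacles shape the proof. \<open>A\<close> need not be solid, so a large value of a
  positive functional at |a| says nothing about its value at a, where the parts a^+ and a^- may
  cancel. For the counterexamples to (2) and (4) the disjoint elements are therefore first cut down
  to lie below a^+ or below a^-; the component of g carried by such an element then vanishes on the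
  other part of a. Likewise an L-set controls f_n and not |f_n|, so weak nullity is needed for every
  sequence dominated by the disjoint one, not only for that sequence itself. Moreover E need not
  admit band projections. A component of g is obtained as a supremum of g over an ideal, and
  disjointness of functionals is used in approximate form: every positive x splits into two positive
  pieces such that each functional is small on one of them. Exactly disjoint elements are then
  recovered from pairs (a - b)^+ and (b - a)^+, with a and b scaled so that the functionals lose
  little.\<close>

section \<open>Disjoint elements, order and norm in a Banach lattice\<close>

lemma disjoint_mono:
  fixes a b :: "'a::banach_lattice"
  assumes "inf a b = 0" "0 \<le> a'" "a' \<le> a" "0 \<le> b'" "b' \<le> b"
  shows "inf a' b' = 0"
proof (rule order.antisym)
  show "inf a' b' \<le> 0" using inf_mono[OF assms(3,5)] assms(1) by simp
qed (use assms in simp)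

lemma disjoint_sup_diff:
  fixes a b :: "'a::banach_lattice"
  shows "inf (sup (a - b) 0) (sup (b - a) 0) = 0"
proof -
  have "sup (a - b) 0 = a - inf a b"
    by (simp add: diff_inf_eq_sup add_sup_distrib_left sup_commute)
  moreover have "sup (b - a) 0 = b - inf a b"
    by (simp add: diff_inf_eq_sup add_sup_distrib_left sup_commute)
  moreover have "inf (a + - inf a b) (b + - inf a b) = inf a b + - inf a b"
    by (rule add_inf_distrib_right[symmetric])
  ultimately show ?thesis by (simp only: diff_conv_add_uminus right_minus)
qed

lemma scaleR_inf:
  fixes a b :: "'a::banach_lattice"
  assumes "0 < c"
  shows "c *\<^sub>R inf a b = inf (c *\<^sub>R a) (c *\<^sub>R b)"
proof (rule order.antisym)
  show "c *\<^sub>R inf a b \<le> inf (c *\<^sub>R a) (c *\<^sub>R b)"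
    using assms by (simp add: scaleR_left_mono)
  have "inverse c *\<^sub>R inf (c *\<^sub>R a) (c *\<^sub>R b) \<le> inverse c *\<^sub>R (c *\<^sub>R a)"
    "inverse c *\<^sub>R inf (c *\<^sub>R a) (c *\<^sub>R b) \<le> inverse c *\<^sub>R (c *\<^sub>R b)"
    using assms by (intro scaleR_left_mono; simp)+
  then have "inverse c *\<^sub>R inf (c *\<^sub>R a) (c *\<^sub>R b) \<le> inf a b"
    using assms by simp
  then have "c *\<^sub>R (inverse c *\<^sub>R inf (c *\<^sub>R a) (c *\<^sub>R b)) \<le> c *\<^sub>R inf a b"
    using assms by (intro scaleR_left_mono) auto
  then show "inf (c *\<^sub>R a) (c *\<^sub>R b) \<le> c *\<^sub>R inf a b"
    using assms by simp
qed

lemma disjoint_scaleR: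
  fixes a b :: "'a::banach_lattice"
  assumes "inf a b = 0" "0 \<le> c" "0 \<le> d"
  shows "inf (c *\<^sub>R a) (d *\<^sub>R b) = 0"
proof -
  \<comment> \<open>Both scalars are raised to one common factor, because \<open>scaleR_inf\<close>
    scales both arguments alike; adding 1 keeps it positive when both are 0.\<close>
  define m where "m = max c d + 1"
  have ab: "0 \<le> a" "0 \<le> b" using assms(1) by (metis inf_le1, metis inf_le2)
  have m: "0 < m" "c \<le> m" "d \<le> m" using assms unfolding m_def by auto
  have "inf (m *\<^sub>R a) (m *\<^sub>R b) = 0"
    using scaleR_inf[OF m(1), of a b] assms(1) by simp
  then show ?thesis
    by (rule disjoint_mono) (use ab m assms in \<open>auto intro: scaleR_right_mono scaleR_nonneg_nonneg\<close>)
qed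

text \<open>Enlarging c to c + b lets b be pulled out of the infimum: inf (a + b) (c + b) = inf a c
  + b = b. Hence inf (a + b) c lies below both b and c.\<close>

lemma disjoint_add:
  fixes a b :: "'a::banach_lattice"
  assumes "inf a c = 0" "inf b c = 0"
  shows "inf (a + b) c = 0"
proof (rule order.antisym)
  have nn: "0 \<le> a" "0 \<le> b" "0 \<le> c" using assms by (metis inf_le1 inf_le2)+
  have "inf (a + b) c \<le> inf (a + b) (c + b)" using nn by (intro inf_mono) auto
  also have "\<dots> = b" using add_inf_distrib_right[of a c b] assms(1) by simp
  finally have "inf (a + b) c \<le> inf b c" by simp
  then show "inf (a + b) c \<le> 0" using assms by simp
  show "0 \<le> inf (a + b) c" using nn by simp
qed

text \<open>Disjoint summands add up to their supremum, by u + v = inf u v + sup u v.\<close>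

lemma disjoint_sum_le:
  fixes z :: "'i \<Rightarrow> 'a::banach_lattice"
  assumes "finite I" "0 \<le> x"
    and "\<And>i. i \<in> I \<Longrightarrow> 0 \<le> z i" "\<And>i. i \<in> I \<Longrightarrow> z i \<le> x"
    and "\<And>i j. i \<in> I \<Longrightarrow> j \<in> I \<Longrightarrow> i \<noteq> j \<Longrightarrow> inf (z i) (z j) = 0"
  shows "sum z I \<le> x"
  using assms
proof (induction I rule: finite_induct)
  case (insert i I)
  have "inf (sum z J) (z i) = 0" if "J \<subseteq> I" for J
    using finite_subset[OF that insert(1)] that
  proof (induction J rule: finite_induct)
    case empty
    then show ?case using insert.prems(2) by (simp add: inf_absorb1)
  next
    case (insert j J)
    then show ?case
      using insert.prems \<open>i \<notin> I\<close> \<open>\<And>k j. k \<in> Set.insert i I \<Longrightarrow> _ \<Longrightarrow> _ \<Longrightarrow> inf (z k) (z j) = 0\<close>[of j i]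
      by (auto intro!: disjoint_add)
  qed
  then have "inf (sum z I) (z i) = 0" by simp
  then have "sum z I + z i = sup (sum z I) (z i)"
    using add_eq_inf_sup[of "sum z I" "z i"] by simp
  also have "\<dots> \<le> x" using insert by simp
  finally show ?case using insert by (simp add: add.commute)
qed simp

lemma norm_mono_nonneg:
  fixes x y :: "'a::banach_lattice"
  assumes "0 \<le> x" "x \<le> y" shows "norm x \<le> norm y"
  using assms by (intro norm_mono_abs) (simp add: abs_of_nonneg_lattice order_trans[OF assms])

lemma norm_abs_banach_lattice: "norm \<bar>x\<bar> = norm x" for x :: "'a::banach_lattice"
  by (rule order.antisym; rule norm_mono_abs; simp)

lemma abs_diff_le_of_bounds:
  fixes u x :: "'a::banach_lattice"
  assumes "0 \<le> u" "u \<le> x" shows "\<bar>2 *\<^sub>R u - x\<bar> \<le> x"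
proof (rule abs_leI)
  show "2 *\<^sub>R u - x \<le> x"
    using add_mono[OF assms(2,2)] by (simp add: scaleR_2 diff_le_eq)
  show "- (2 *\<^sub>R u - x) \<le> x"
    using assms(1) order_trans[of "- u" 0 u] by (simp add: scaleR_2)
qed

text \<open>The positive part of -l is dominated by |x_n - l|, whose norm tends to 0.\<close>

lemma nonneg_limit:
  fixes x :: "nat \<Rightarrow> 'a::banach_lattice"
  assumes "x \<longlonglongrightarrow> l" "\<And>n. 0 \<le> x n"
  shows "0 \<le> l"
proof -
  have "norm (sup (- l) 0) \<le> norm (x n - l)" for n
  proof -
    have "- l \<le> x n - l" using assms(2)[of n] by simp
    also have "\<dots> \<le> \<bar>x n - l\<bar>" by (rule abs_ge_self)
    finally have "sup (- l) 0 \<le> \<bar>x n - l\<bar>" by simp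
    then show ?thesis
      using norm_mono_nonneg[of "sup (- l) 0" "\<bar>x n - l\<bar>"] by (simp add: norm_abs_banach_lattice)
  qed
  moreover have "(\<lambda>n. norm (x n - l)) \<longlonglongrightarrow> 0"
    using assms(1) by (simp add: LIM_zero tendsto_norm_zero)
  ultimately have "norm (sup (- l) 0) \<le> 0"
    by (meson LIMSEQ_le_const)
  then have "sup (- l) 0 = 0" by simp
  then have "- l \<le> 0" by (metis sup_ge1)
  then show ?thesis by simp
qed

lemma term_le_suminf:
  fixes x :: "nat \<Rightarrow> 'a::banach_lattice"
  assumes "summable x" "\<And>n. 0 \<le> x n"
  shows "x k \<le> suminf x"
proof -
  have "(\<lambda>n. sum x {..<n + Suc k} - x k) \<longlonglongrightarrow> suminf x - x k"
    using summable_LIMSEQ[OF assms(1)]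
    by (intro tendsto_diff tendsto_const LIMSEQ_ignore_initial_segment)
  moreover have "0 \<le> sum x {..<n + Suc k} - x k" for n
    using sum_mono2[of "{..<n + Suc k}" "{k}" x] assms(2) by simp
  ultimately show ?thesis
    using nonneg_limit by fastforce
qed

section \<open>Positive functionals, Riesz-Kantorovich suprema and the modulus in the dual\<close>

lemma dual_pos_mono: "dual_le 0 p \<Longrightarrow> x \<le> y \<Longrightarrow> blinfun_apply p x \<le> blinfun_apply p y"
  unfolding dual_le_def by (metis blinfun.diff_right diff_ge_0_iff_ge zero_blinfun.rep_eq)

lemma dual_pos_nonneg: "dual_le 0 p \<Longrightarrow> 0 \<le> x \<Longrightarrow> 0 \<le> blinfun_apply p x"
  by (simp add: dual_le_def)

lemma dual_le_refl: "dual_le f f"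
  by (simp add: dual_le_def)

lemma dual_le_trans: "dual_le f g \<Longrightarrow> dual_le g h \<Longrightarrow> dual_le f h"
  unfolding dual_le_def by (meson order_trans)

text \<open>For \<open>I = UNIV\<close> the functional \<open>h\<close> is the positive part of \<open>f\<close>; for positive \<open>f\<close> and a
  principal ideal \<open>I\<close> it is the component of \<open>f\<close> carried by \<open>I\<close>.\<close>

lemma riesz_kantorovich_on_ideal:
  fixes f :: "'a::banach_lattice \<Rightarrow>\<^sub>L real"
  assumes I0: "0 \<in> I" and Iadd: "\<And>x y. x \<in> I \<Longrightarrow> y \<in> I \<Longrightarrow> x + y \<in> I"
    and Iscale: "\<And>c x. 0 < c \<Longrightarrow> x \<in> I \<Longrightarrow> c *\<^sub>R x \<in> I"
    and Isolid: "\<And>x y. 0 \<le> x \<Longrightarrow> x \<le> y \<Longrightarrow> y \<in> I \<Longrightarrow> x \<in> I"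
  obtains h where "\<And>x y. y \<in> I \<Longrightarrow> 0 \<le> y \<Longrightarrow> y \<le> x \<Longrightarrow> blinfun_apply f y \<le> blinfun_apply h x"
    and "\<And>x c. 0 \<le> x \<Longrightarrow> (\<And>y. y \<in> I \<Longrightarrow> 0 \<le> y \<Longrightarrow> y \<le> x \<Longrightarrow> blinfun_apply f y \<le> c) \<Longrightarrow> blinfun_apply h x \<le> c"
proof -
  define p where "p x = (SUP y\<in>I \<inter> {0..x}. blinfun_apply f y)" for x
  have fle: "blinfun_apply f y \<le> norm f * norm x" if "0 \<le> y" "y \<le> x" for x y
  proof -
    have "norm f * norm y \<le> norm f * norm x"
      using norm_mono_nonneg[OF that] by (simp add: mult_left_mono)
    then show ?thesis using norm_blinfun[of f y] by simp
  qed
  have bdd: "bdd_above (blinfun_apply f ` (I \<inter> {0..x}))" for x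
    using fle by (intro bdd_aboveI[of _ "norm f * norm x"]) auto
  have upper: "blinfun_apply f y \<le> p x" if "y \<in> I" "0 \<le> y" "y \<le> x" for x y
    unfolding p_def using that by (intro cSUP_upper bdd) auto
  have least: "p x \<le> c" if "0 \<le> x" "\<And>y. y \<in> I \<Longrightarrow> 0 \<le> y \<Longrightarrow> y \<le> x \<Longrightarrow> blinfun_apply f y \<le> c" for x c
    unfolding p_def using that I0 by (intro cSUP_least) auto
  have nonneg: "0 \<le> p x" if "0 \<le> x" for x
    using upper[of 0 x] I0 that by (simp add: blinfun.zero_right)
  have bound: "p x \<le> norm f * norm x" if "0 \<le> x" for x
    using that fle by (intro least)
  have add: "p (x + z) = p x + p z" if x: "0 \<le> x" and z: "0 \<le> z" for x z
  proof (rule order.antisym)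
    show "p (x + z) \<le> p x + p z"
    proof (rule least)
      show "0 \<le> x + z" using x z by simp
      fix y assume y: "y \<in> I" "0 \<le> y" "y \<le> x + z"
      \<comment> \<open>Riesz decomposition: \<open>y\<close> splits into \<open>inf y x\<close>,
        which lies below \<open>x\<close>, and a rest below \<open>z\<close>; solidity keeps both
        pieces in \<open>I\<close>.\<close>
      have e: "y - inf y x = sup 0 (y - x)"
        by (simp add: diff_inf_eq_sup add_sup_distrib_left)
      have "sup 0 (y - x) \<le> z" using y z by (simp add: diff_le_eq add.commute)
      moreover have "inf y x \<in> I" using Isolid[of "inf y x" y] x y by simp
      moreover have "y - inf y x \<in> I"
      proof (rule Isolid)
        show "0 \<le> y - inf y x" unfolding e by simp
        show "y - inf y x \<le> y" unfolding e using x y by simp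
      qed (rule y)
      ultimately have "blinfun_apply f (y - inf y x) \<le> p z" "blinfun_apply f (inf y x) \<le> p x"
        using x y e by (auto intro!: upper)
      then show "blinfun_apply f y \<le> p x + p z"
        unfolding blinfun.diff_right by linarith
    qed
    have "p x \<le> p (x + z) - p z"
    proof (rule least[OF x])
      fix y assume y: "y \<in> I" "0 \<le> y" "y \<le> x"
      have "p z \<le> p (x + z) - blinfun_apply f y"
      proof (rule least[OF z])
        fix w assume w: "w \<in> I" "0 \<le> w" "w \<le> z"
        have "blinfun_apply f (y + w) \<le> p (x + z)"
          using y w by (intro upper) (auto intro: add_mono Iadd)
        then show "blinfun_apply f w \<le> p (x + z) - blinfun_apply f y"
          by (simp add: blinfun.add_right)
      qed
      then show "blinfun_apply f y \<le> p (x + z) - p z" by simp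
    qed
    then show "p x + p z \<le> p (x + z)" by simp
  qed
  have scale_le: "p (c *\<^sub>R x) \<le> c * p x" if "0 \<le> x" "0 < c" for c x
  proof (rule least)
    show "0 \<le> c *\<^sub>R x" using that by (simp add: scaleR_nonneg_nonneg)
    fix y assume y: "y \<in> I" "0 \<le> y" "y \<le> c *\<^sub>R x"
    have "inverse c *\<^sub>R y \<le> inverse c *\<^sub>R (c *\<^sub>R x)" "0 \<le> inverse c *\<^sub>R y" "inverse c *\<^sub>R y \<in> I"
      using y that by (auto intro!: scaleR_left_mono scaleR_nonneg_nonneg Iscale simp del: scaleR_scaleR)
    then have "blinfun_apply f (inverse c *\<^sub>R y) \<le> p x"
      using that by (intro upper) auto
    then show "blinfun_apply f y \<le> c * p x"
      using that by (simp add: blinfun.scaleR_right field_simps)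
  qed
  have scale: "p (c *\<^sub>R x) = c * p x" if x: "0 \<le> x" and c: "0 < c" for c x
  proof (rule order.antisym[OF scale_le[OF x c]])
    have "p (inverse c *\<^sub>R (c *\<^sub>R x)) \<le> inverse c * p (c *\<^sub>R x)"
      using x c by (intro scale_le) (auto simp: scaleR_nonneg_nonneg)
    then show "c * p x \<le> p (c *\<^sub>R x)" using c by (simp add: field_simps)
  qed
  define h where "h x = p (sup x 0) - p (sup (- x) 0)" for x
  \<comment> \<open>The value does not depend on the chosen decomposition into positive elements.
    Linearity can thus be checked on any decomposition, although positive parts are not
    additive.\<close>
  have h_diff: "h (a - b) = p a - p b" if "0 \<le> a" "0 \<le> b" for a b
  proof -
    have "a - b = sup (a - b) 0 - sup (- (a - b)) 0" by (rule banach_lattice_split)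
    then have "a + sup (- (a - b)) 0 = sup (a - b) 0 + b"
      by (metis add.commute diff_add_eq diff_eq_eq)
    then have "p (a + sup (- (a - b)) 0) = p (sup (a - b) 0 + b)" by simp
    then show ?thesis using that by (simp add: h_def add del: minus_diff_eq)
  qed
  have p0: "p 0 = 0" using add[of 0 0] by simp
  have h_pos: "h x = p x" if "0 \<le> x" for x
    using h_diff[of x 0] that p0 by simp
  have split: "\<exists>a b. x = a - b \<and> 0 \<le> a \<and> 0 \<le> b" for x :: 'a
    using banach_lattice_split[of x] sup_ge2 by blast
  have "bounded_linear h"
  proof (rule bounded_linear_intro[where K = "norm f"])
    show "h (x + y) = h x + h y" for x y
    proof -
      obtain a b where x: "x = a - b" "0 \<le> a" "0 \<le> b" using split by blast
      obtain c d where y: "y = c - d" "0 \<le> c" "0 \<le> d" using split by blast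
      have "x + y = (a + c) - (b + d)" using x y by simp
      then have "h (x + y) = p (a + c) - p (b + d)" using x y by (simp only: h_diff add_nonneg_nonneg)
      then show ?thesis using x y by (simp add: h_diff add)
    qed
    show "h (c *\<^sub>R x) = c *\<^sub>R h x" for c x
    proof -
      obtain a b where x: "x = a - b" "0 \<le> a" "0 \<le> b" using split by blast
      consider "c = 0" | "0 < c" | "0 < - c" by linarith
      then show ?thesis
      proof cases
        case 1 then show ?thesis using h_pos[of 0] p0 by simp
      next
        case 2
        then have "h (c *\<^sub>R a - c *\<^sub>R b) = p (c *\<^sub>R a) - p (c *\<^sub>R b)"
          using x by (intro h_diff) (auto intro: scaleR_nonneg_nonneg)
        then show ?thesis
          using 2 x by (simp add: scale h_diff scaleR_right_diff_distrib right_diff_distrib)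
      next
        case 3
        then have "h ((- c) *\<^sub>R b - (- c) *\<^sub>R a) = p ((- c) *\<^sub>R b) - p ((- c) *\<^sub>R a)"
          using x by (intro h_diff) (auto intro: scaleR_nonneg_nonneg simp del: scaleR_minus_left)
        moreover have "(- c) *\<^sub>R b - (- c) *\<^sub>R a = c *\<^sub>R x"
          using x by (simp add: scaleR_right_diff_distrib)
        ultimately show ?thesis
          using scale[of b "-c"] scale[of a "-c"] 3 x by (simp add: h_diff right_diff_distrib)
      qed
    qed
    show "norm (h x) \<le> norm x * norm f" for x
    proof -
      have "norm f * norm (sup x 0) \<le> norm f * norm x"
        "norm f * norm (sup (- x) 0) \<le> norm f * norm x"
        using norm_pos_part_le[of x] norm_pos_part_le[of "- x"] by (auto intro: mult_left_mono)
      then show ?thesis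
        using bound[of "sup x 0"] bound[of "sup (- x) 0"]
          nonneg[of "sup x 0"] nonneg[of "sup (- x) 0"]
        by (simp add: h_def mult.commute abs_le_iff)
    qed
  qed
  then have app: "blinfun_apply (Blinfun h) = h" by (rule bounded_linear_Blinfun_apply)
  show thesis
  proof (rule that[of "Blinfun h"])
    show "blinfun_apply f y \<le> blinfun_apply (Blinfun h) x" if "y \<in> I" "0 \<le> y" "y \<le> x" for x y
      using upper[OF that] order_trans[OF that(2,3)] by (simp add: app h_pos)
    show "blinfun_apply (Blinfun h) x \<le> c"
      if "0 \<le> x" "\<And>y. y \<in> I \<Longrightarrow> 0 \<le> y \<Longrightarrow> y \<le> x \<Longrightarrow> blinfun_apply f y \<le> c" for x c
      using least[OF that] that(1) by (simp add: app h_pos)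
  qed
qed

lemma abs_eq_pos_parts: "\<bar>x\<bar> = sup x 0 + sup (- x) 0" for x :: "'a::banach_lattice"
proof -
  have "inf x 0 = - sup (- x) 0" using inf_eq_neg_sup[of x 0] by (simp only: minus_zero)
  then show ?thesis by (simp only: abs_prts pprt_def nprt_def diff_minus_eq_add)
qed

lemma dual_abs_upper:
  shows "dual_le f (dual_abs f)" "dual_le (- f) (dual_abs f)"
  unfolding dual_abs_def using theI'[OF dual_sup_exists, folded dual_sup_def] by blast+

lemma dual_abs_least: "dual_le f k \<Longrightarrow> dual_le (- f) k \<Longrightarrow> dual_le (dual_abs f) k"
  unfolding dual_abs_def using theI'[OF dual_sup_exists, folded dual_sup_def] by blast

lemma dual_inf_greatest: "dual_le k f \<Longrightarrow> dual_le k g \<Longrightarrow> dual_le k (dual_inf f g)"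
  using theI'[OF dual_inf_exists, folded dual_inf_def] by blast

lemma dual_inf_eqI:
  assumes "dual_le h f" "dual_le h g"
    and "\<And>k. dual_le k f \<Longrightarrow> dual_le k g \<Longrightarrow> dual_le k h"
  shows "dual_inf f g = h"
proof (rule dual_le_antisym)
  note I = theI'[OF dual_inf_exists, folded dual_inf_def]
  show "dual_le h (dual_inf f g)" using assms(1,2) by (rule dual_inf_greatest)
  show "dual_le (dual_inf f g) h" using I[of f g] by (intro assms(3)) blast+
qed

lemma dual_abs_pos: "dual_le 0 (dual_abs f)"
  unfolding dual_le_def
proof (intro allI impI)
  fix x :: 'a assume "0 \<le> x"
  then show "blinfun_apply 0 x \<le> blinfun_apply (dual_abs f) x"
    using dual_abs_upper[of f, unfolded dual_le_def, rule_format, of x]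
    by (simp add: blinfun.minus_left)
qed

lemma dual_abs_of_pos:
  assumes "dual_le 0 p" shows "dual_abs p = p"
proof (rule dual_le_antisym)
  show "dual_le (dual_abs p) p"
    using assms by (intro dual_abs_least dual_le_refl) (auto simp: dual_le_def blinfun.minus_left intro: order_trans[of _ 0])
qed (rule dual_abs_upper)

lemma abs_apply_le_dual_abs: "\<bar>blinfun_apply f x\<bar> \<le> blinfun_apply (dual_abs f) \<bar>x\<bar>"
proof -
  have le: "\<bar>blinfun_apply f y\<bar> \<le> blinfun_apply (dual_abs f) y" if "0 \<le> y" for y
    using dual_abs_upper[of f, unfolded dual_le_def, rule_format, OF that]
    by (simp add: blinfun.minus_left)
  have "blinfun_apply f x = blinfun_apply f (sup x 0) - blinfun_apply f (sup (- x) 0)"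
    using arg_cong[OF banach_lattice_split[of x], of "blinfun_apply f"]
    by (simp only: blinfun.diff_right)
  then show ?thesis
    using le[OF sup_ge2[of 0 x]] le[OF sup_ge2[of 0 "- x"]]
    unfolding abs_eq_pos_parts[of x] blinfun.add_right by linarith
qed

text \<open>Since |f| = (2f)^+ - f, the value |f|(x) is the supremum of f(2y - x) over 0 <= y <= x,
  and these elements 2y - x lie between -x and x.\<close>

lemma dual_abs_approx:
  fixes f :: "'a::banach_lattice \<Rightarrow>\<^sub>L real"
  assumes "0 \<le> x" "0 < e"
  obtains u where "\<bar>u\<bar> \<le> x" "blinfun_apply (dual_abs f) x - e < blinfun_apply f u"
proof -
  obtain h where h: "\<And>x y. y \<in> UNIV \<Longrightarrow> 0 \<le> y \<Longrightarrow> y \<le> x \<Longrightarrow> blinfun_apply (2 *\<^sub>R f) y \<le> blinfun_apply h x"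
    "\<And>x c. 0 \<le> x \<Longrightarrow> (\<And>y. y \<in> UNIV \<Longrightarrow> 0 \<le> y \<Longrightarrow> y \<le> x \<Longrightarrow> blinfun_apply (2 *\<^sub>R f) y \<le> c) \<Longrightarrow> blinfun_apply h x \<le> c"
    by (rule riesz_kantorovich_on_ideal[of UNIV "2 *\<^sub>R f"]) auto
  have "dual_le (dual_abs f) (h - f)"
  proof (rule dual_abs_least)
    show "dual_le f (h - f)"
      using h(1)[of x x for x] by (auto simp: dual_le_def blinfun.diff_left blinfun.scaleR_left)
    show "dual_le (- f) (h - f)"
      using h(1)[of 0] by (auto simp: dual_le_def blinfun.diff_left blinfun.minus_left blinfun.zero_right)
  qed
  then have le: "blinfun_apply (dual_abs f) x \<le> blinfun_apply h x - blinfun_apply f x"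
    using assms by (simp add: dual_le_def blinfun.diff_left)
  have "\<exists>y. 0 \<le> y \<and> y \<le> x \<and> blinfun_apply (dual_abs f) x - e + blinfun_apply f x < 2 * blinfun_apply f y"
  proof (rule ccontr)
    assume "\<not> ?thesis"
    then have "blinfun_apply h x \<le> blinfun_apply (dual_abs f) x - e + blinfun_apply f x"
      using assms by (intro h(2)) (auto simp: blinfun.scaleR_left not_less)
    then show False using le assms by simp
  qed
  then obtain y where y: "0 \<le> y" "y \<le> x"
    "blinfun_apply (dual_abs f) x - e + blinfun_apply f x < 2 * blinfun_apply f y" by blast
  show thesis
  proof (rule that)
    show "\<bar>2 *\<^sub>R y - x\<bar> \<le> x" using y by (intro abs_diff_le_of_bounds)
    show "blinfun_apply (dual_abs f) x - e < blinfun_apply f (2 *\<^sub>R y - x)"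
      using y by (simp add: blinfun.diff_right blinfun.scaleR_right)
  qed
qed

lemma norm_dual_abs_le:
  assumes "0 \<le> x" shows "blinfun_apply (dual_abs f) x \<le> norm f * norm x"
proof (rule field_le_epsilon)
  fix e :: real assume "0 < e"
  then obtain u where u: "\<bar>u\<bar> \<le> x" "blinfun_apply (dual_abs f) x - e < blinfun_apply f u"
    by (rule dual_abs_approx[OF assms])
  have "blinfun_apply f u \<le> norm f * norm u" using norm_blinfun[of f u] by simp
  also have "\<dots> \<le> norm f * norm x"
    using u(1) assms by (intro mult_left_mono norm_mono_abs) (auto simp: abs_of_nonneg_lattice)
  finally show "blinfun_apply (dual_abs f) x \<le> norm f * norm x + e" using u by simp
qed

section \<open>Disjoint functionals and the disjoint elements that almost carry them\<close>

text \<open>Disjointness of positive functionals in a form that does not mention the dual lattice.\<close>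

definition separated :: "('a::banach_lattice \<Rightarrow>\<^sub>L real) \<Rightarrow> ('a \<Rightarrow>\<^sub>L real) \<Rightarrow> bool" where
  "separated p q \<longleftrightarrow> (\<forall>x\<ge>0. \<forall>e>0. \<exists>y\<ge>0. y \<le> x \<and>
     blinfun_apply p (x - y) < e \<and> blinfun_apply q y < e)"

lemma separatedE:
  assumes "separated p q" "0 \<le> x" "0 < e"
  obtains y where "0 \<le> y" "y \<le> x" "blinfun_apply p (x - y) < e" "blinfun_apply q y < e"
proof -
  have "\<exists>y\<ge>0. y \<le> x \<and> blinfun_apply p (x - y) < e \<and> blinfun_apply q y < e"
    using assms unfolding separated_def by simp
  then obtain y where "0 \<le> y \<and> y \<le> x \<and> blinfun_apply p (x - y) < e \<and> blinfun_apply q y < e" ..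
  then show thesis using that[of y] by simp
qed

text \<open>As the infimum of p and q is p - (p - q)^+, disjointness forces (p - q)^+ = p. So p(x)
  is the supremum of p - q over [0, x], and a y attaining it up to e satisfies p(x - y) + q(y) <
  e.\<close>

lemma separated_if_dual_inf_0:
  fixes p q :: "'a::banach_lattice \<Rightarrow>\<^sub>L real"
  assumes p: "dual_le 0 p" and q: "dual_le 0 q" and pq: "dual_inf p q = 0"
  shows "separated p q"
  unfolding separated_def
proof (intro allI impI)
  fix x :: 'a and e :: real assume x: "0 \<le> x" and e: "0 < e"
  obtain h where h: "\<And>x y. y \<in> UNIV \<Longrightarrow> 0 \<le> y \<Longrightarrow> y \<le> x \<Longrightarrow> blinfun_apply (p - q) y \<le> blinfun_apply h x"
    "\<And>x c. 0 \<le> x \<Longrightarrow> (\<And>y. y \<in> UNIV \<Longrightarrow> 0 \<le> y \<Longrightarrow> y \<le> x \<Longrightarrow> blinfun_apply (p - q) y \<le> c) \<Longrightarrow> blinfun_apply h x \<le> c"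
    by (rule riesz_kantorovich_on_ideal[of UNIV "p - q"]) auto
  have "dual_le (p - h) (dual_inf p q)"
  proof (rule dual_inf_greatest)
    show "dual_le (p - h) p"
      using h(1)[of 0] by (auto simp: dual_le_def blinfun.diff_left blinfun.zero_right)
    show "dual_le (p - h) q"
      unfolding dual_le_def blinfun.diff_left
    proof (intro allI impI)
      fix x :: 'a assume "0 \<le> x"
      then show "blinfun_apply p x - blinfun_apply h x \<le> blinfun_apply q x"
        using h(1)[of x x] by (simp add: blinfun.diff_left)
    qed
  qed
  then have le: "blinfun_apply p x \<le> blinfun_apply h x"
    using x by (simp add: pq dual_le_def blinfun.diff_left)
  have "\<exists>y. 0 \<le> y \<and> y \<le> x \<and> blinfun_apply p x - e < blinfun_apply (p - q) y"
  proof (rule ccontr)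
    assume "\<not> ?thesis"
    then have "blinfun_apply h x \<le> blinfun_apply p x - e"
      using x by (intro h(2)) (auto simp: not_less)
    then show False using le e by simp
  qed
  then obtain y where y: "0 \<le> y" "y \<le> x" "blinfun_apply p x - e < blinfun_apply (p - q) y" by blast
  then show "\<exists>y\<ge>0. y \<le> x \<and> blinfun_apply p (x - y) < e \<and> blinfun_apply q y < e"
    using dual_pos_nonneg[OF p, of "x - y"] dual_pos_nonneg[OF q, of y]
    by (intro exI[of _ y]) (simp add: blinfun.diff_left blinfun.diff_right)
qed

text \<open>The infimum of the two splitting elements serves both: \<open>q\<close> and
  \<open>r\<close> only decrease, and its remainder is at most the sum of the two remainders, on
  which \<open>p\<close> is small.\<close>

lemma separated_add:
  fixes p q r :: "'a::banach_lattice \<Rightarrow>\<^sub>L real"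
  assumes pos: "dual_le 0 p" "dual_le 0 q" "dual_le 0 r" and "separated p q" "separated p r"
  shows "separated p (q + r)"
  unfolding separated_def
proof (intro allI impI)
  fix x :: 'a and e :: real assume x: "0 \<le> x" and e: "0 < e"
  obtain y where y: "0 \<le> y" "y \<le> x" "blinfun_apply p (x - y) < e / 2" "blinfun_apply q y < e / 2"
    by (rule separatedE[OF assms(4) x half_gt_zero[OF e]])
  obtain z where z: "0 \<le> z" "z \<le> x" "blinfun_apply p (x - z) < e / 2" "blinfun_apply r z < e / 2"
    by (rule separatedE[OF assms(5) x half_gt_zero[OF e]])
  have "x - inf y z = sup (x - y) (x - z)"
    by (simp add: diff_inf_eq_sup add_sup_distrib_left)
  also have "\<dots> \<le> (x - y) + (x - z)" using y z by simp
  finally have "blinfun_apply p (x - inf y z) \<le> blinfun_apply p (x - y) + blinfun_apply p (x - z)"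
    using dual_pos_mono[OF pos(1)] unfolding blinfun.add_right[symmetric] by simp
  moreover have "blinfun_apply q (inf y z) \<le> blinfun_apply q y" "blinfun_apply r (inf y z) \<le> blinfun_apply r z"
    using pos by (simp_all add: dual_pos_mono)
  moreover have "inf y z \<le> x" using inf_le1 y(2) by (rule order_trans)
  ultimately show "\<exists>y\<ge>0. y \<le> x \<and> blinfun_apply p (x - y) < e \<and> blinfun_apply (q + r) y < e"
    using y z by (intro exI[of _ "inf y z"]) (simp add: blinfun.add_left)
qed

lemma separated_sum:
  fixes p :: "'a::banach_lattice \<Rightarrow>\<^sub>L real"
  assumes "finite I" "dual_le 0 p" "\<And>i. i \<in> I \<Longrightarrow> dual_le 0 (q i)" "\<And>i. i \<in> I \<Longrightarrow> separated p (q i)"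
  shows "separated p (\<Sum>i\<in>I. q i) \<and> dual_le 0 (\<Sum>i\<in>I. q i)"
  using assms
proof (induction I rule: finite_induct)
  case empty
  then show ?case by (auto simp: separated_def dual_le_def intro!: exI[of _ x for x])
next
  case (insert i I)
  have "dual_le 0 (q i + (\<Sum>i\<in>I. q i))"
    using insert by (auto simp: dual_le_def blinfun.add_left)
  then show ?case
    using insert.hyps insert.IH insert.prems separated_add[of p "q i" "\<Sum>i\<in>I. q i"] by simp
qed

text \<open>Induction on \<open>I\<close>: one functional is separated from the sum of the others by
  some \<open>y\<close>, this splitting is sharpened to two disjoint elements \<open>a\<close> and
  \<open>b\<close>, and the other functionals are treated inside [0, b].\<close>

lemma separated_disjoint_elements:
  fixes f :: "'i \<Rightarrow> 'a::banach_lattice \<Rightarrow>\<^sub>L real"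
  assumes "finite I" "\<And>i. i \<in> I \<Longrightarrow> dual_le 0 (f i)"
    and "\<And>i j. i \<in> I \<Longrightarrow> j \<in> I \<Longrightarrow> i \<noteq> j \<Longrightarrow> separated (f i) (f j)"
    and "0 \<le> x" "0 < e"
  obtains v where "\<forall>i\<in>I. 0 \<le> v i \<and> v i \<le> x \<and> blinfun_apply (f i) (x - v i) < e"
    "\<forall>i\<in>I. \<forall>j\<in>I. i \<noteq> j \<longrightarrow> inf (v i) (v j) = 0"
proof -
  have "\<exists>v. (\<forall>i\<in>I. 0 \<le> v i \<and> v i \<le> x \<and> blinfun_apply (f i) (x - v i) < e) \<and>
    (\<forall>i\<in>I. \<forall>j\<in>I. i \<noteq> j \<longrightarrow> inf (v i) (v j) = 0)"
    using assms
  proof (induction I arbitrary: x e rule: finite_induct)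
    case (insert j I)
    have "separated (f j) (\<Sum>i\<in>I. f i)"
    proof (rule conjunct1[OF separated_sum])
      show "finite I" by (rule insert.hyps)
      show "dual_le 0 (f j)" by (rule insert.prems) simp
      fix i assume i: "i \<in> I"
      then show "dual_le 0 (f i)" by (intro insert.prems) simp
      show "separated (f j) (f i)" using i \<open>j \<notin> I\<close> by (intro insert.prems) auto
    qed
    then obtain y where y: "0 \<le> y" "y \<le> x" "blinfun_apply (f j) (x - y) < e / 4"
      "blinfun_apply (\<Sum>i\<in>I. f i) y < e / 4"
      by (rule separatedE[where e = "e / 4"]) (use \<open>0 \<le> x\<close> \<open>0 < e\<close> in simp_all)
    \<comment> \<open>Sharpening only doubles the error, as x - a <= 2(x - y) and x - b <= 2y. The
      others thus lose less than e / 2 in passing to \<open>b\<close>, which leaves e / 2 for the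
      induction below \<open>b\<close>.\<close>
    define a where "a = sup (2 *\<^sub>R y - x) 0"
    define b where "b = sup (x - 2 *\<^sub>R y) 0"
    have ab: "inf a b = 0" unfolding a_def b_def by (rule disjoint_sup_diff)
    have a: "0 \<le> a" "a \<le> x" unfolding a_def
      using add_mono[OF y(2,2)] \<open>0 \<le> x\<close> by (auto simp: scaleR_2 diff_le_eq)
    have b: "0 \<le> b" "b \<le> x" unfolding b_def
      using add_mono[OF y(1,1)] \<open>0 \<le> x\<close> by (auto simp: scaleR_2 diff_le_eq)
    have "x - a \<le> 2 *\<^sub>R (x - y)"
    proof -
      have "2 *\<^sub>R y - x \<le> a" unfolding a_def by simp
      then have "x - a \<le> x - (2 *\<^sub>R y - x)" by (rule diff_left_mono)
      then show ?thesis by (simp add: scaleR_2 algebra_simps)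
    qed
    then have "blinfun_apply (f j) (x - a) \<le> blinfun_apply (f j) (2 *\<^sub>R (x - y))"
      using insert.prems(1)[of j] by (intro dual_pos_mono) auto
    then have fa: "blinfun_apply (f j) (x - a) < e"
      using y \<open>0 < e\<close> by (simp add: blinfun.scaleR_right)
    have fb: "blinfun_apply (f i) (x - b) < e / 2" if i: "i \<in> I" for i
    proof -
      have "x - 2 *\<^sub>R y \<le> b" unfolding b_def by simp
      then have "x - b \<le> 2 *\<^sub>R y" by (simp add: diff_le_eq add.commute)
      then have "blinfun_apply (f i) (x - b) \<le> blinfun_apply (f i) (2 *\<^sub>R y)"
        using insert.prems(1)[of i] i by (intro dual_pos_mono) auto
      moreover have "blinfun_apply (f i) y \<le> (\<Sum>i\<in>I. blinfun_apply (f i) y)"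
      proof (rule member_le_sum[OF i])
        show "0 \<le> blinfun_apply (f k) y" if "k \<in> I - {i}" for k
          using that y(1) insert.prems(1)[of k] by (simp add: dual_pos_nonneg)
      qed (rule insert.hyps)
      ultimately show ?thesis using y by (simp add: blinfun.scaleR_right blinfun.sum_left)
    qed
    have "\<exists>v. (\<forall>i\<in>I. 0 \<le> v i \<and> v i \<le> b \<and> blinfun_apply (f i) (b - v i) < e / 2) \<and>
        (\<forall>i\<in>I. \<forall>j\<in>I. i \<noteq> j \<longrightarrow> inf (v i) (v j) = 0)"
    proof (rule insert.IH)
      show "dual_le 0 (f i)" if "i \<in> I" for i using that by (intro insert.prems) simp
      show "separated (f i) (f k)" if "i \<in> I" "k \<in> I" "i \<noteq> k" for i k
        using that by (intro insert.prems) simp_all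
      show "0 \<le> b" by (rule b)
      show "0 < e / 2" using \<open>0 < e\<close> by simp
    qed
    then obtain v where v': "\<forall>i\<in>I. 0 \<le> v i \<and> v i \<le> b \<and> blinfun_apply (f i) (b - v i) < e / 2"
      "\<forall>i\<in>I. \<forall>j\<in>I. i \<noteq> j \<longrightarrow> inf (v i) (v j) = 0"
      by (elim exE conjE)
    note v = bspec[OF v'(1)] v'(2)[rule_format]
    have av: "inf a (v i) = 0" if "i \<in> I" for i
      using disjoint_mono[OF ab a(1) order_refl, of "v i"] v(1)[OF that] by simp
    have fv: "blinfun_apply (f i) (x - v i) < e" if "i \<in> I" for i
      using fb[OF that] v(1)[OF that] by (simp add: blinfun.diff_right)
    have vx: "v i \<le> x" if "i \<in> I" for i
      using order_trans[of "v i" b x] v(1)[OF that] b(2) by simp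
    have va: "inf (v i) a = 0" if "i \<in> I" for i
      using av[OF that] by (simp only: inf_commute)
    show ?case
    proof (intro exI[of _ "v(j := a)"] conjI ballI impI)
      fix i assume i: "i \<in> Set.insert j I"
      have "0 \<le> (v(j := a)) i \<and> (v(j := a)) i \<le> x \<and> blinfun_apply (f i) (x - (v(j := a)) i) < e"
      proof (cases "i = j")
        case True then show ?thesis using a fa by simp
      next
        case False then show ?thesis using i v(1)[of i] vx[of i] fv[of i] by simp
      qed
      then show "0 \<le> (v(j := a)) i" "(v(j := a)) i \<le> x"
        "blinfun_apply (f i) (x - (v(j := a)) i) < e" by blast+
      fix k assume "k \<in> Set.insert j I" "i \<noteq> k"
      then show "inf ((v(j := a)) i) ((v(j := a)) k) = 0"
        using i av[of k] va[of i] v(2)[of i k] by (cases "i = j"; cases "k = j") simp_all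
    qed
  qed auto
  then obtain v where "(\<forall>i\<in>I. 0 \<le> v i \<and> v i \<le> x \<and> blinfun_apply (f i) (x - v i) < e) \<and>
    (\<forall>i\<in>I. \<forall>j\<in>I. i \<noteq> j \<longrightarrow> inf (v i) (v j) = 0)" ..
  then show thesis using that by (elim conjE)
qed

text \<open>Each f_i(x) is nearly f_i(v_i) <= g(v_i) for suitable disjoint v_i in [0, x], and
  disjoint v_i sum to at most x. This gives the l1 bounds for order bounded disjoint sequences in
  the dual.\<close>

lemma separated_sum_le:
  fixes f :: "'i \<Rightarrow> 'a::banach_lattice \<Rightarrow>\<^sub>L real"
  assumes I: "finite I" and pos: "\<And>i. i \<in> I \<Longrightarrow> dual_le 0 (f i)" and g: "\<And>i. i \<in> I \<Longrightarrow> dual_le (f i) g"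
    and sep: "\<And>i j. i \<in> I \<Longrightarrow> j \<in> I \<Longrightarrow> i \<noteq> j \<Longrightarrow> separated (f i) (f j)"
    and "dual_le 0 g" and x: "0 \<le> x"
  shows "(\<Sum>i\<in>I. blinfun_apply (f i) x) \<le> blinfun_apply g x"
proof (rule field_le_epsilon)
  fix e :: real assume e: "0 < e"
  define d where "d = e / (real (card I) + 1)"
  have d: "0 < d" "real (card I) * d \<le> e" using e unfolding d_def by (auto simp: field_simps)
  obtain v where v': "\<forall>i\<in>I. 0 \<le> v i \<and> v i \<le> x \<and> blinfun_apply (f i) (x - v i) < d"
    "\<forall>i\<in>I. \<forall>j\<in>I. i \<noteq> j \<longrightarrow> inf (v i) (v j) = 0"
    by (rule separated_disjoint_elements[OF I pos sep x d(1)])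
  note v = bspec[OF v'(1)] v'(2)[rule_format]
  have "(\<Sum>i\<in>I. blinfun_apply (f i) x) \<le> (\<Sum>i\<in>I. blinfun_apply g (v i) + d)"
  proof (rule sum_mono)
    fix i assume i: "i \<in> I"
    have "blinfun_apply (f i) (v i) \<le> blinfun_apply g (v i)"
      using g[OF i] v(1)[OF i] by (simp add: dual_le_def)
    then show "blinfun_apply (f i) x \<le> blinfun_apply g (v i) + d"
      using v(1)[OF i] by (simp add: blinfun.diff_right)
  qed
  also have "\<dots> = blinfun_apply g (sum v I) + card I * d"
    by (simp add: sum.distrib blinfun.sum_right)
  also have "\<dots> \<le> blinfun_apply g x + e"
  proof (rule add_mono)
    have "sum v I \<le> x" by (rule disjoint_sum_le[OF I x]) (use v in simp_all)
    then show "blinfun_apply g (sum v I) \<le> blinfun_apply g x"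
      by (rule dual_pos_mono[OF \<open>dual_le 0 g\<close>])
    show "real (card I) * d \<le> e" by (rule d)
  qed
  finally show "(\<Sum>i\<in>I. blinfun_apply (f i) x) \<le> blinfun_apply g x + e" .
qed

section \<open>Subsequences and the Schur property\<close>

lemma infinite_subsequence:
  assumes "\<not> (\<forall>\<^sub>F n in sequentially. \<not> P n)"
  obtains r :: "nat \<Rightarrow> nat" where "strict_mono r" "\<forall>k. P (r k)"
proof -
  have "infinite {n. P n}"
    using assms unfolding infinite_nat_iff_unbounded_le eventually_sequentially by simp
  then obtain r :: "nat \<Rightarrow> nat" where r: "strict_mono r" "\<forall>n. r n \<in> {n. P n}"
    using infinite_enumerate by metis
  show thesis by (rule that[OF r(1)]) (use r(2) in simp)
qed

text \<open>In the window from N + 1 to M only the index m is summed; everything else in the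
  subseries is bounded by the head up to N and the tail from M + 1 on.\<close>

lemma summable_split_at:
  fixes b :: "nat \<Rightarrow> real"
  assumes "summable (\<lambda>i. \<bar>b i\<bar>)" and K: "K \<inter> {N<..M} = {m}"
  shows "\<bar>\<Sum>i. if i \<in> K then b i else 0\<bar>
    \<ge> \<bar>b m\<bar> - (\<Sum>i\<le>N. \<bar>b i\<bar>) - (\<Sum>i. \<bar>b (i + Suc M)\<bar>)"
proof -
  define c where "c i = (if i \<in> K then b i else 0)" for i
  have cb: "\<bar>c i\<bar> \<le> \<bar>b i\<bar>" for i by (simp add: c_def)
  have sc: "summable (\<lambda>i. \<bar>c i\<bar>)" 
    by (rule summable_comparison_test[OF _ assms(1)]) (use cb in auto)
  then have sc': "summable c" by (rule summable_rabs_cancel)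
  have tail: "\<bar>\<Sum>i. c (i + Suc M)\<bar> \<le> (\<Sum>i. \<bar>b (i + Suc M)\<bar>)"
  proof -
    have s: "summable (\<lambda>i. \<bar>c (i + Suc M)\<bar>)" "summable (\<lambda>i. \<bar>b (i + Suc M)\<bar>)"
      by (rule summable_ignore_initial_segment[OF sc], rule summable_ignore_initial_segment[OF assms(1)])
    have "\<bar>\<Sum>i. c (i + Suc M)\<bar> \<le> (\<Sum>i. \<bar>c (i + Suc M)\<bar>)"
      by (rule summable_rabs[OF s(1)])
    also have "\<dots> \<le> (\<Sum>i. \<bar>b (i + Suc M)\<bar>)"
      by (rule suminf_le[OF cb s])
    finally show ?thesis .
  qed
  have m: "N < m" "m \<le> M" "m \<in> K" using K by auto
  have "sum c {..<Suc M} = sum c ({..N} \<union> {m})"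
  proof (rule sum.mono_neutral_right)
    show "\<forall>i\<in>{..<Suc M} - ({..N} \<union> {m}). c i = 0"
    proof
      fix i assume "i \<in> {..<Suc M} - ({..N} \<union> {m})"
      then have "i \<in> {N<..M}" "i \<notin> K \<inter> {N<..M}" unfolding K by auto
      then show "c i = 0" by (simp add: c_def)
    qed
  qed (use m in auto)
  also have "\<dots> = sum c {..N} + b m"
    using m by (subst sum.union_disjoint) (auto simp: c_def)
  finally have "suminf c = (\<Sum>i. c (i + Suc M)) + sum c {..N} + b m"
    using suminf_split_initial_segment[OF sc', of "Suc M"] by simp
  moreover have "\<bar>sum c {..N}\<bar> \<le> (\<Sum>i\<le>N. \<bar>b i\<bar>)"
    using sum_abs[of c "{..N}"] sum_mono[of "{..N}" "\<lambda>i. \<bar>c i\<bar>" "\<lambda>i. \<bar>b i\<bar>", OF cb] by linarith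
  ultimately show ?thesis using tail unfolding c_def[symmetric] by linarith
qed

text \<open>Gliding hump, as in the proof of the Schur property of \<open>\<ell>\<^sub>1\<close>.\<close>

lemma schur_uniform_convergence:
  fixes a :: "nat \<Rightarrow> nat \<Rightarrow> real"
  assumes sa: "\<And>n. summable (\<lambda>i. \<bar>a n i\<bar>)"
    and lim: "\<And>K. (\<lambda>n. \<Sum>i. if i \<in> K then a n i else 0) \<longlonglongrightarrow> 0"
    and e: "0 < e"
  shows "\<forall>\<^sub>F n in sequentially. \<forall>i. \<bar>a n i\<bar> < e"
proof (rule ccontr)
  assume "\<not> ?thesis"
  then have "\<not> (\<forall>\<^sub>F n in sequentially. \<not> (\<exists>i. e \<le> \<bar>a n i\<bar>))" by (simp add: not_le)
  then have inf: "\<exists>n\<ge>N. \<exists>i. e \<le> \<bar>a n i\<bar>" for N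
    by (auto simp: eventually_sequentially)
  have col: "(\<lambda>n. a n i) \<longlonglongrightarrow> 0" for i
  proof -
    have "(\<Sum>j. if j \<in> {i} then a n j else 0) = a n i" for n
      using suminf_finite[of "{i}" "\<lambda>j. if j \<in> {i} then a n j else 0"] by simp
    then show ?thesis using lim[of "{i}"] by simp
  qed
  \<comment> \<open>A state (n, m, M) built beyond \<open>L\<close>: row \<open>n\<close> has a
    large entry at \<open>m\<close> in the window from L + 1 to M and mass below e / 4 on each side
    of that window. The next window starts after \<open>M\<close>.\<close>
  define G where "G L = (\<lambda>(n, m, M). n \<ge> L \<and> L < m \<and> m \<le> M \<and> e \<le> \<bar>a n m\<bar>
    \<and> (\<Sum>i\<le>L. \<bar>a n i\<bar>) < e / 4 \<and> (\<Sum>i. \<bar>a n (i + Suc M)\<bar>) < e / 4)" for L :: nat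
  have step: "\<exists>s. G L s" for L
  proof -
    have "(\<lambda>n. \<Sum>i\<le>L. \<bar>a n i\<bar>) \<longlonglongrightarrow> (\<Sum>i\<le>L. \<bar>0\<bar>)"
      by (intro tendsto_sum tendsto_rabs col)
    then have "\<forall>\<^sub>F n in sequentially. (\<Sum>i\<le>L. \<bar>a n i\<bar>) < e / 4"
      using e by (intro order_tendstoD(2)[where y = 0]) auto
    then obtain N where N: "\<And>n. n \<ge> N \<Longrightarrow> (\<Sum>i\<le>L. \<bar>a n i\<bar>) < e / 4"
      by (auto simp: eventually_sequentially)
    obtain n m where nm: "n \<ge> max N L" "e \<le> \<bar>a n m\<bar>" using inf by blast
    have small: "(\<Sum>i\<le>L. \<bar>a n i\<bar>) < e / 4" using N nm by simp
    have "L < m"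
    proof (rule ccontr)
      assume "\<not> L < m"
      then have "\<bar>a n m\<bar> \<le> (\<Sum>i\<le>L. \<bar>a n i\<bar>)" by (intro member_le_sum) auto
      then show False using small nm e by linarith
    qed
    have "(\<lambda>M. \<Sum>i. \<bar>a n (i + M)\<bar>) \<longlonglongrightarrow> 0"
      using suminf_exist_split2[OF sa[of n]] by simp
    then have "\<forall>\<^sub>F M in sequentially. (\<Sum>i. \<bar>a n (i + M)\<bar>) < e / 4"
      using e by (intro order_tendstoD(2)[where y = 0]) auto
    then obtain M0 where "\<And>M. M \<ge> M0 \<Longrightarrow> (\<Sum>i. \<bar>a n (i + M)\<bar>) < e / 4"
      by (auto simp: eventually_sequentially)
    from this[of "Suc (max m M0)"] have "G L (n, m, max m M0)"
      using nm small \<open>L < m\<close> unfolding G_def by simp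
    then show ?thesis ..
  qed
  have "\<exists>s. \<forall>k::nat. True \<and> G (snd (snd (s k))) (s (Suc k))"
    using step by (intro dependent_nat_choice) auto
  then obtain s where s: "\<And>k::nat. G (snd (snd (s k))) (s (Suc k))" by blast
  define n where "n k = fst (s (Suc k))" for k
  define m where "m k = fst (snd (s (Suc k)))" for k
  define M where "M k = snd (snd (s k))" for k
  have G: "n k \<ge> M k" "M k < m k" "m k \<le> M (Suc k)" "e \<le> \<bar>a (n k) (m k)\<bar>"
    "(\<Sum>i\<le>M k. \<bar>a (n k) i\<bar>) < e / 4" "(\<Sum>i. \<bar>a (n k) (i + Suc (M (Suc k)))\<bar>) < e / 4" for k
    using s[of k] unfolding G_def n_def m_def M_def by (auto simp: case_prod_beta)
  have M: "strict_mono M"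
    using G(2,3) by (intro strict_monoI_Suc) (meson less_le_trans)
  \<comment> \<open>\<open>K\<close> meets each window in one index, so in row \<open>n k\<close>
    the sum over \<open>K\<close> is at least e - e / 4 - e / 4 in modulus.\<close>
  define K where "K = range m"
  have big: "e / 2 \<le> \<bar>\<Sum>i. if i \<in> K then a (n k) i else 0\<bar>" for k
  proof -
    have uniq: "j = k" if "m j \<in> {M k<..M (Suc k)}" for j
    proof -
      have "M k < M (Suc j)" "M j < M (Suc k)" using that G(2,3)[of j] by auto
      then have "k < Suc j" "j < Suc k" by (simp_all only: strict_mono_less[OF M])
      then show ?thesis by linarith
    qed
    have "K \<inter> {M k<..M (Suc k)} = {m k}"
    proof (rule set_eqI, rule iffI)
      fix i assume "i \<in> K \<inter> {M k<..M (Suc k)}"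
      then obtain j where "i = m j" "m j \<in> {M k<..M (Suc k)}" unfolding K_def by auto
      then show "i \<in> {m k}" using uniq[of j] by simp
    next
      fix i assume "i \<in> {m k}"
      then show "i \<in> K \<inter> {M k<..M (Suc k)}" using G(2,3)[of k] unfolding K_def by simp
    qed
    then have "\<bar>a (n k) (m k)\<bar> - (\<Sum>i\<le>M k. \<bar>a (n k) i\<bar>) - (\<Sum>i. \<bar>a (n k) (i + Suc (M (Suc k)))\<bar>)
      \<le> \<bar>\<Sum>i. if i \<in> K then a (n k) i else 0\<bar>"
      by (rule summable_split_at[OF sa])
    then show ?thesis using G(4-6)[of k] by linarith
  qed
  obtain N where N: "\<And>j. j \<ge> N \<Longrightarrow> \<bar>\<Sum>i. if i \<in> K then a j i else 0\<bar> < e / 2"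
    using LIMSEQ_D[OF lim[of K], of "e / 2"] e by auto
  have "N \<le> n N" using strict_mono_imp_increasing[OF M, of N] G(1)[of N] by (rule order_trans)
  show False using leD[OF big[of N]] N[OF \<open>N \<le> n N\<close>] by (rule notE)
qed

section \<open>Selecting disjoint elements below a fixed element\<close>

text \<open>One step of the selection of disjoint elements below: among many disjoint elements
  \<open>z\<^sub>i \<le> x\<close> carrying the functionals \<open>f\<^sub>i\<close>, one is almost invisible to infinitely many
  other functionals.\<close>

lemma separated_selection_step:
  fixes f :: "nat \<Rightarrow> 'a::banach_lattice \<Rightarrow>\<^sub>L real"
  assumes pos: "\<And>n. dual_le 0 (f n)" and sep: "\<And>n m. n \<noteq> m \<Longrightarrow> separated (f n) (f m)"
    and S: "infinite S" and x: "0 \<le> x" and M: "\<And>n. blinfun_apply (f n) x \<le> M" and e: "0 < e"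
  obtains i S' w x' where "i \<in> S" "S' \<subseteq> S" "infinite S'" "\<forall>m\<in>S'. i < m"
    "0 \<le> w" "w \<le> x" "0 \<le> x'" "x' \<le> x" "inf w x' = 0"
    "blinfun_apply (f i) (x - w) \<le> e" "\<forall>m\<in>S'. blinfun_apply (f m) (x - x') \<le> e"
proof -
  have M0: "0 \<le> M" using dual_pos_nonneg[OF pos x, of 0] M[of 0] by linarith
  \<comment> \<open>Cutting \<open>h *\<^sub>R x\<close> off \<open>z i\<close> will cost at most h
    M <= e / 2; M + 1 avoids a division by 0.\<close>
  define h where "h = e / (2 * (M + 1))"
  have h: "0 < h" "h * M \<le> e / 2" using M0 e unfolding h_def by (auto simp: field_simps)
  obtain N :: nat where N: "M / (e * h) < N" using reals_Archimedean2 by blast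
  have N1: "M < real N * (e * h)" using N e h by (simp add: pos_divide_less_eq)
  obtain I where I: "I \<subseteq> S" "finite I" "card I = N"
    using infinite_arbitrarily_large[OF S] by metis
  have e2: "0 < e / 2" using e by simp
  obtain z where z': "\<forall>i\<in>I. 0 \<le> z i \<and> z i \<le> x \<and> blinfun_apply (f i) (x - z i) < e / 2"
    "\<forall>i\<in>I. \<forall>j\<in>I. i \<noteq> j \<longrightarrow> inf (z i) (z j) = 0"
    by (rule separated_disjoint_elements[OF I(2) pos sep x e2])
  note z = bspec[OF z'(1)] z'(2)[rule_format]
  \<comment> \<open>Pigeonhole: the disjoint \<open>z i\<close> sum to at most \<open>x\<close>, so
    N values above e h would exceed the bound \<open>M\<close>. Each m is thus assigned to one of
    finitely many i, and some i receives infinitely many m.\<close>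
  have small: "\<exists>i\<in>I. blinfun_apply (f m) (z i) \<le> e * h" for m
  proof (rule ccontr)
    assume "\<not> ?thesis"
    then have "(\<Sum>i\<in>I. e * h) \<le> (\<Sum>i\<in>I. blinfun_apply (f m) (z i))"
      by (intro sum_mono) auto
    also have "\<dots> = blinfun_apply (f m) (sum z I)" by (simp add: blinfun.sum_right)
    also have "\<dots> \<le> blinfun_apply (f m) x"
      using z by (intro dual_pos_mono[OF pos] disjoint_sum_le[OF I(2) x]) auto
    also have "\<dots> \<le> M" by (rule M)
    finally show False using N1 I by simp
  qed
  have "\<exists>i\<in>I. infinite {m \<in> S. blinfun_apply (f m) (z i) \<le> e * h}"
  proof (rule ccontr)
    assume "\<not> ?thesis"
    then have "finite (\<Union>i\<in>I. {m \<in> S. blinfun_apply (f m) (z i) \<le> e * h})"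
      using I by simp
    moreover have "S \<subseteq> (\<Union>i\<in>I. {m \<in> S. blinfun_apply (f m) (z i) \<le> e * h})"
      using small by auto
    ultimately show False using S finite_subset by blast
  qed
  then obtain i where i: "i \<in> I" and inf: "infinite {m \<in> S. blinfun_apply (f m) (z i) \<le> e * h}"
    by blast
  define S' where "S' = {m \<in> S. blinfun_apply (f m) (z i) \<le> e * h} - {..i}"
  \<comment> \<open>Up to the factor \<open>h\<close> these are the positive parts of an element and
    of its negative, hence disjoint. Here f_i loses at most e / 2 + h M, and f_m at most (1/h)(e h)
    = e.\<close>
  define w where "w = sup (z i - h *\<^sub>R x) 0"
  define x' where "x' = sup (x - inverse h *\<^sub>R z i) 0"
  have zi: "0 \<le> z i" "z i \<le> x" "blinfun_apply (f i) (x - z i) < e / 2" using z(1)[OF i] by auto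
  have hx: "0 \<le> h *\<^sub>R x" "0 \<le> inverse h *\<^sub>R z i" using h x zi by (auto intro!: scaleR_nonneg_nonneg)
  show thesis
  proof (rule that[of i S' w x'])
    show "i \<in> S" "S' \<subseteq> S" "infinite S'" "\<forall>m\<in>S'. i < m"
      using i I inf unfolding S'_def by auto
    show "0 \<le> w" "0 \<le> x'" unfolding w_def x'_def by auto
    show "w \<le> x" "x' \<le> x"
      unfolding w_def x'_def using zi hx x order_trans[of "z i" x "x + h *\<^sub>R x"] by (auto simp: diff_le_eq)
    have "h *\<^sub>R x' = sup (h *\<^sub>R x - z i) 0"
    proof -
      have "h *\<^sub>R inf (- (x - inverse h *\<^sub>R z i)) 0 = inf (- (h *\<^sub>R x - z i)) 0"
        using h by (simp add: scaleR_inf scaleR_right_diff_distrib)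
      moreover have "x' = - inf (- (x - inverse h *\<^sub>R z i)) 0"
        "sup (h *\<^sub>R x - z i) 0 = - inf (- (h *\<^sub>R x - z i)) 0"
        unfolding x'_def by (simp_all only: neg_inf_eq_sup minus_minus minus_zero)
      ultimately show ?thesis by (simp only: scaleR_minus_right)
    qed
    then have "inf w (h *\<^sub>R x') = 0"
      unfolding w_def by (simp only: disjoint_sup_diff)
    from disjoint_scaleR[OF this, of 1 "inverse h"] h show "inf w x' = 0" by simp
    have "z i - h *\<^sub>R x \<le> w" unfolding w_def by simp
    then have "x - w \<le> x - (z i - h *\<^sub>R x)" by (rule diff_left_mono)
    then have "x - w \<le> (x - z i) + h *\<^sub>R x" by (simp add: algebra_simps)
    from dual_pos_mono[OF pos[of i] this]
    have "blinfun_apply (f i) (x - w) \<le> blinfun_apply (f i) (x - z i) + h * blinfun_apply (f i) x"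
      by (simp add: blinfun.add_right blinfun.scaleR_right)
    moreover have "h * blinfun_apply (f i) x \<le> h * M" using h M by (intro mult_left_mono) auto
    ultimately show "blinfun_apply (f i) (x - w) \<le> e" using zi h by linarith
    show "\<forall>m\<in>S'. blinfun_apply (f m) (x - x') \<le> e"
    proof
      fix m assume m: "m \<in> S'"
      have "x - inverse h *\<^sub>R z i \<le> x'" unfolding x'_def by simp
      then have "x - x' \<le> inverse h *\<^sub>R z i" by (simp add: diff_le_eq add.commute)
      from dual_pos_mono[OF pos[of m] this]
      have "blinfun_apply (f m) (x - x') \<le> inverse h * blinfun_apply (f m) (z i)"
        by (simp add: blinfun.scaleR_right)
      also have "\<dots> \<le> inverse h * (e * h)"
        using m h unfolding S'_def by (intro mult_left_mono) auto
      finally show "blinfun_apply (f m) (x - x') \<le> e" using h by (simp add: field_simps)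
    qed
  qed
qed

text \<open>The step is iterated inside a shrinking remainder y_k: w_k lies below y_k and is
  disjoint from y_(k+1), which dominates all later w_j.\<close>

lemma separated_selection:
  fixes f :: "nat \<Rightarrow> 'a::banach_lattice \<Rightarrow>\<^sub>L real"
  assumes pos: "\<And>n. dual_le 0 (f n)" and sep: "\<And>n m. n \<noteq> m \<Longrightarrow> separated (f n) (f m)"
    and x: "0 \<le> x" and M: "\<And>n. blinfun_apply (f n) x \<le> M" and e: "0 < e"
  obtains r w where "strict_mono r" "\<forall>k. 0 \<le> w k" "\<forall>k. w k \<le> x"
    "\<forall>j k. j \<noteq> k \<longrightarrow> inf (w j) (w k) = 0"
    "\<forall>k::nat. blinfun_apply (f (r k)) (x - w k) \<le> e"
proof -
  \<comment> \<open>The k-th step may lose e / 2^(k+1); \<open>d k\<close> is the loss accumulated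
    before it and never exceeds e.\<close>
  define d where "d k = e * (1 - (1/2)^k)" for k :: nat
  define P where "P k = (\<lambda>(y, S, _ :: nat, _ :: 'a). 0 \<le> y \<and> y \<le> x \<and> infinite S \<and> (\<forall>m\<in>S. blinfun_apply (f m) (x - y) \<le> d k))"
    for k
  \<comment> \<open>A state holds the remaining element and the remaining index set; its last two
    components record the index and the element selected on the way to it and are dummies in the
    initial state.\<close>
  define Q where "Q k = (\<lambda>(y, S, _ :: nat, _ :: 'a) (y', S', i, w). i \<in> S \<and> S' \<subseteq> S \<and> (\<forall>m\<in>S'. i < m) \<and> 0 \<le> w \<and> w \<le> y
    \<and> y' \<le> y \<and> inf w y' = 0 \<and> blinfun_apply (f i) (y - w) \<le> d (Suc k) - d k)" for k
  have dd: "0 < d (Suc k) - d k" "d k \<le> e" for k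
    using e unfolding d_def by (auto simp: algebra_simps)
  have "\<exists>s. \<forall>k. P k (s k) \<and> Q k (s k) (s (Suc k))"
  proof (rule dependent_nat_choice)
    show "\<exists>s. P 0 s"
      by (intro exI[of _ "(x, UNIV, 0, 0)"]) (simp add: P_def d_def x blinfun.zero_right)
    fix s k assume "P k s"
    then obtain y S i w where s: "s = (y, S, i, w)" and y: "0 \<le> y" "y \<le> x" and S: "infinite S"
      and fy: "\<And>m. m \<in> S \<Longrightarrow> blinfun_apply (f m) (x - y) \<le> d k"
      by (cases s) (auto simp: P_def)
    have My: "blinfun_apply (f n) y \<le> M" for n
      using dual_pos_mono[OF pos[of n] y(2)] M[of n] by linarith
    obtain i S' w y' where *: "i \<in> S" "S' \<subseteq> S" "infinite S'" "\<forall>m\<in>S'. i < m"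
      "0 \<le> w" "w \<le> y" "0 \<le> y'" "y' \<le> y" "inf w y' = 0"
      "blinfun_apply (f i) (y - w) \<le> d (Suc k) - d k"
      "\<forall>m\<in>S'. blinfun_apply (f m) (y - y') \<le> d (Suc k) - d k"
      by (rule separated_selection_step[OF pos sep S y(1) My dd(1)])
    have "blinfun_apply (f m) (x - y') \<le> d (Suc k)" if "m \<in> S'" for m
      using bspec[OF *(11) that] fy[OF subsetD[OF *(2) that]] unfolding blinfun.diff_right by linarith
    then have "P (Suc k) (y', S', i, w)"
      unfolding P_def using *(3,7) order_trans[OF *(8) y(2)] by simp
    moreover have "Q k s (y', S', i, w)"
      unfolding Q_def s prod.case by (intro conjI *)
    ultimately show "\<exists>s'. P (Suc k) s' \<and> Q k s s'" by blast
  qed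
  then obtain s where sP: "\<And>k. P k (s k)" and sQ: "\<And>k. Q k (s k) (s (Suc k))" by blast
  define y where "y k = fst (s k)" for k
  define S where "S k = fst (snd (s k))" for k
  define r where "r k = fst (snd (snd (s (Suc k))))" for k
  define w where "w k = snd (snd (snd (s (Suc k))))" for k
  have yS: "0 \<le> y k" "y k \<le> x" "\<And>m. m \<in> S k \<Longrightarrow> blinfun_apply (f m) (x - y k) \<le> d k" for k
    using sP[of k] unfolding P_def y_def S_def by (auto simp: case_prod_beta)
  have rw': "r k \<in> S k \<and> S (Suc k) \<subseteq> S k \<and> (\<forall>m\<in>S (Suc k). r k < m) \<and>
    0 \<le> w k \<and> w k \<le> y k \<and> y (Suc k) \<le> y k \<and> inf (w k) (y (Suc k)) = 0 \<and>
    blinfun_apply (f (r k)) (y k - w k) \<le> d (Suc k) - d k" for k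
    using sQ[of k] unfolding Q_def y_def S_def r_def w_def case_prod_beta .
  have rw: "r k \<in> S k" "\<forall>m\<in>S (Suc k). r k < m"
    "0 \<le> w k" "w k \<le> y k" "y (Suc k) \<le> y k" "inf (w k) (y (Suc k)) = 0"
    "blinfun_apply (f (r k)) (y k - w k) \<le> d (Suc k) - d k" for k
    using rw'[of k] by - (elim conjE, assumption)+
  have disj: "inf (w j) (w k) = 0" if "j < k" for j k
  proof -
    have "y k \<le> y (Suc j)"
      by (rule lift_Suc_antimono_le[of y, OF rw(5)]) (use that in simp)
    from order_trans[OF rw(4) this] show ?thesis
      by (rule disjoint_mono[OF rw(6)[of j] rw(3) order_refl rw(3)])
  qed
  show thesis
  proof (rule that; (intro allI impI)?)
    show "strict_mono r" using rw(1,2) by (intro strict_monoI_Suc) blast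
    show "0 \<le> w k" for k by (rule rw)
    show "w k \<le> x" for k using rw(4) yS(2) by (rule order_trans)
    show "inf (w j) (w k) = 0" if "j \<noteq> k" for j k
    proof (cases "j < k")
      case False
      with that have "inf (w k) (w j) = 0" by (intro disj) simp
      then show ?thesis by (subst inf_commute)
    qed (rule disj)
    show "blinfun_apply (f (r k)) (x - w k) \<le> e" for k
      using yS(3)[OF rw(1)[of k]] rw(7)[of k] dd(2)[of "Suc k"] unfolding blinfun.diff_right
      by linarith
  qed
qed

section \<open>Norm estimates in the dual, and weakly null disjoint sequences\<close>

lemma dual_le_norm_mono:
  assumes "dual_le 0 p" "dual_le p g" and f: "\<And>x. \<bar>blinfun_apply f x\<bar> \<le> blinfun_apply p \<bar>x\<bar>"
  shows "norm f \<le> norm g"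
proof (rule norm_blinfun_bound)
  fix x
  have "\<bar>blinfun_apply f x\<bar> \<le> blinfun_apply g \<bar>x\<bar>"
    using f[of x] assms(2) unfolding dual_le_def by (meson abs_ge_zero order_trans)
  also have "\<dots> \<le> norm g * norm \<bar>x\<bar>"
    using norm_blinfun[of g "\<bar>x\<bar>"] by simp
  finally show "norm (blinfun_apply f x) \<le> norm g * norm x"
    by (simp add: norm_abs_banach_lattice)
qed simp

lemma abs_apply_pos_le: "dual_le 0 p \<Longrightarrow> \<bar>blinfun_apply p x\<bar> \<le> blinfun_apply p \<bar>x\<bar>"
  using abs_apply_le_dual_abs[of p x] by (simp add: dual_abs_of_pos)

lemma norm_dual_abs: "norm (dual_abs f) \<le> norm f"
proof (rule norm_blinfun_bound)
  fix x
  have "\<bar>blinfun_apply (dual_abs f) x\<bar> \<le> blinfun_apply (dual_abs f) \<bar>x\<bar>"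
    by (rule abs_apply_pos_le[OF dual_abs_pos])
  also have "\<dots> \<le> norm f * norm \<bar>x\<bar>"
    by (rule norm_dual_abs_le) simp
  finally show "norm (blinfun_apply (dual_abs f) x) \<le> norm f * norm x"
    by (simp add: norm_abs_banach_lattice)
qed simp

text \<open>The values |f|(w_k) are summable, because disjoint elements below x have partial sums
  below x; they dominate |f(u_k)|.\<close>

lemma order_bounded_disjoint_weakly_null:
  fixes u w :: "nat \<Rightarrow> 'a::banach_lattice"
  assumes u: "\<And>k. \<bar>u k\<bar> \<le> w k" and w: "\<And>k. w k \<le> x"
    and disj: "\<And>j k. j \<noteq> k \<Longrightarrow> inf (w j) (w k) = 0"
  shows "weakly_null u"
  unfolding weakly_null_iff
proof
  fix f :: "'a \<Rightarrow>\<^sub>L real"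
  have w0: "0 \<le> w k" for k using abs_ge_zero u by (rule order_trans)
  then have x0: "0 \<le> x" using w by (rule order_trans)
  have "summable (\<lambda>k. blinfun_apply (dual_abs f) (w k))"
  proof (rule summableI_nonneg_bounded)
    show "0 \<le> blinfun_apply (dual_abs f) (w k)" for k
      by (rule dual_pos_nonneg[OF dual_abs_pos w0])
    show "(\<Sum>k<n. blinfun_apply (dual_abs f) (w k)) \<le> blinfun_apply (dual_abs f) x" for n
      unfolding blinfun.sum_right[symmetric]
      by (intro dual_pos_mono[OF dual_abs_pos] disjoint_sum_le x0 w0 w disj) simp
  qed
  then have "(\<lambda>k. blinfun_apply (dual_abs f) (w k)) \<longlonglongrightarrow> 0"
    by (rule summable_LIMSEQ_zero)
  moreover have "\<forall>k. norm (blinfun_apply f (u k)) \<le> blinfun_apply (dual_abs f) (w k)"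
  proof
    fix k
    have "\<bar>blinfun_apply f (u k)\<bar> \<le> blinfun_apply (dual_abs f) \<bar>u k\<bar>"
      by (rule abs_apply_le_dual_abs)
    also have "\<dots> \<le> blinfun_apply (dual_abs f) (w k)"
      by (rule dual_pos_mono[OF dual_abs_pos u])
    finally show "norm (blinfun_apply f (u k)) \<le> blinfun_apply (dual_abs f) (w k)"
      unfolding real_norm_def .
  qed
  ultimately show "(\<lambda>k. blinfun_apply f (u k)) \<longlonglongrightarrow> 0"
    by (rule Lim_null_comparison[OF always_eventually, rotated])
qed

section \<open>Disjoint sequences on which positive functionals stay large\<close>

text \<open>Two things are removed from x_(r k): a large multiple of the earlier selected elements,
  which is cheap because \<open>r\<close> grows so fast that f_(r k) is tiny on them, and a small
  multiple of one element z with z >= 2^-i x_(r i) for all i, which takes care of the later ones and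
  is cheap by norm boundedness. Each removal costs at most e / 4.\<close>

lemma disjoint_sequence_below:
  fixes f :: "nat \<Rightarrow> 'a::banach_lattice \<Rightarrow>\<^sub>L real" and x :: "nat \<Rightarrow> 'a"
  assumes pos: "\<And>n. dual_le 0 (f n)" and C: "\<And>n. norm (f n) \<le> C"
    and null: "\<And>y. 0 \<le> y \<Longrightarrow> (\<lambda>n. blinfun_apply (f n) y) \<longlonglongrightarrow> 0"
    and x: "\<And>n. 0 \<le> x n" and B: "\<And>n. norm (x n) \<le> B"
    and e: "0 < e" and ge: "\<And>n. e \<le> blinfun_apply (f n) (x n)"
  obtains r y where "strict_mono r" "\<forall>k. 0 \<le> y k" "\<forall>k. y k \<le> x (r k)"
    "\<forall>j k. j \<noteq> k \<longrightarrow> inf (y j) (y k) = 0"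
    "\<forall>k::nat. e / 2 \<le> blinfun_apply (f (r k)) (y k)"
proof -
  \<comment> \<open>The factor 4 ^ Suc k anticipates the multiple of the earlier elements that is
    going to be removed; the sum runs over all indices up to \<open>r k\<close>, so it covers the
    selected ones.\<close>
  have "\<exists>r. \<forall>k::nat. True \<and> (r k < r (Suc k) \<and>
    4 ^ Suc k * blinfun_apply (f (r (Suc k))) (\<Sum>i\<le>r k. x i) \<le> e / 4)"
  proof (rule dependent_nat_choice)
    fix n k :: nat
    have "(\<lambda>m. blinfun_apply (f m) (\<Sum>i\<le>n. x i)) \<longlonglongrightarrow> 0"
      by (intro null sum_nonneg x)
    then have "\<forall>\<^sub>F m in sequentially. blinfun_apply (f m) (\<Sum>i\<le>n. x i) < e / 4 / 4 ^ Suc k"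
      by (rule order_tendstoD(2)) (simp add: e)
    then obtain m where m: "n < m" "blinfun_apply (f m) (\<Sum>i\<le>n. x i) < e / 4 / 4 ^ Suc k"
      using eventually_happens[OF eventually_conj[OF eventually_gt_at_top[of n]]] by auto
    have "4 ^ Suc k * blinfun_apply (f m) (\<Sum>i\<le>n. x i) \<le> 4 ^ Suc k * (e / 4 / 4 ^ Suc k)"
      using m(2) by (intro mult_left_mono) auto
    then have "4 ^ Suc k * blinfun_apply (f m) (\<Sum>i\<le>n. x i) \<le> e / 4" by simp
    with m(1) show "\<exists>m. True \<and> (n < m \<and> 4 ^ Suc k * blinfun_apply (f m) (\<Sum>i\<le>n. x i) \<le> e / 4)"
      by auto
  qed simp
  then obtain r where r: "\<And>k::nat. r k < r (Suc k)"
    "\<And>k. 4 ^ Suc k * blinfun_apply (f (r (Suc k))) (\<Sum>i\<le>r k. x i) \<le> e / 4"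
    by auto
  have mono: "strict_mono r" using r(1) by (rule strict_monoI_Suc)
  define v where "v k = (\<Sum>i<k. x (r i))" for k
  have v_small: "4 ^ k * blinfun_apply (f (r k)) (v k) \<le> e / 4" for k
  proof (cases k)
    case 0
    then show ?thesis using e by (simp add: v_def blinfun.zero_right)
  next
    case (Suc l)
    have "v k = sum x (r ` {..<k})"
      unfolding v_def by (rule sum.reindex_cong[symmetric, of r]) (use strict_mono_imp_inj_on[OF mono] in auto)
    also have "\<dots> \<le> (\<Sum>i\<le>r l. x i)"
      using Suc x strict_mono_less_eq[OF mono] by (intro sum_mono2) auto
    finally have "blinfun_apply (f (r k)) (v k) \<le> blinfun_apply (f (r k)) (\<Sum>i\<le>r l. x i)"
      by (rule dual_pos_mono[OF pos])
    then have "4 ^ k * blinfun_apply (f (r k)) (v k) \<le> 4 ^ k * blinfun_apply (f (r k)) (\<Sum>i\<le>r l. x i)"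
      by (intro mult_left_mono) auto
    then show ?thesis using r(2)[of l] unfolding Suc by (rule order_trans)
  qed
  have v0: "0 \<le> v k" for k unfolding v_def by (intro sum_nonneg x)
  have xv: "x (r j) \<le> v k" if "j < k" for j k
    using sum_mono2[of "{..<k}" "{j}" "\<lambda>i. x (r i)"] that x unfolding v_def by simp
  define t where "t i = (1/2) ^ i *\<^sub>R x (r i)" for i
  have t0: "0 \<le> t i" for i unfolding t_def by (intro scaleR_nonneg_nonneg x) simp
  have st: "summable t"
  proof (rule summable_comparison_test')
    show "summable (\<lambda>i. (1/2) ^ i * B :: real)" by (intro summable_mult2 summable_geometric) simp
    show "norm (t i) \<le> (1/2) ^ i * B" if "0 \<le> i" for i
      unfolding t_def using B[of "r i"] by (simp add: mult_left_mono)
  qed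
  define z where "z = suminf t"
  have tz: "t i \<le> z" for i unfolding z_def by (rule term_le_suminf[OF st t0])
  have z0: "0 \<le> z" using t0 tz by (rule order_trans)
  (* For j < k, the term 4^k v_k bounds y_k by the positive part of x_k - 4^k x_j, and 2^-j z bounds
     y_j by a multiple of the positive part of 4^k x_j - x_k, whence disjointness. *)
  define y where "y k = sup (x (r k) - (4 ^ k *\<^sub>R v k + (1/2) ^ k *\<^sub>R z)) 0" for k
  have vz0: "0 \<le> (4::real) ^ k *\<^sub>R v k" "0 \<le> (1/2::real) ^ k *\<^sub>R z" for k
    by (intro scaleR_nonneg_nonneg v0 z0; simp)+
  have y0: "0 \<le> y k" for k unfolding y_def by simp
  have yx: "y k \<le> x (r k)" for k
    unfolding y_def using x[of "r k"] add_nonneg_nonneg[OF vz0(1,2), of k k] by (simp add: diff_le_eq)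
  have disj: "inf (y j) (y k) = 0" if jk: "j < k" for j k
  proof -
    have yk: "y k \<le> sup (x (r k) - 4 ^ k *\<^sub>R x (r j)) 0"
      unfolding y_def
    proof (rule sup_mono[OF diff_left_mono order_refl])
      have "(4::real) ^ k *\<^sub>R x (r j) \<le> 4 ^ k *\<^sub>R v k"
        by (intro scaleR_left_mono xv jk) simp
      also have "\<dots> \<le> 4 ^ k *\<^sub>R v k + (1/2) ^ k *\<^sub>R z" using vz0(2)[of k] by simp
      finally show "4 ^ k *\<^sub>R x (r j) \<le> 4 ^ k *\<^sub>R v k + (1/2) ^ k *\<^sub>R z" .
    qed
    have yj: "y j \<le> (1/4) ^ k *\<^sub>R sup (4 ^ k *\<^sub>R x (r j) - x (r k)) 0"
    proof -
      \<comment> \<open>From z >= 2^-k x_(r k) and j < k follows 2^-j z >= 4^-k x_(r k). The weight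
        4^k of \<open>v k\<close> is the reciprocal of this factor, so both bounds involve the same
        difference up to sign and scale.\<close>
      have "(1/4 :: real) ^ k = (1/2) ^ k * (1/2) ^ k"
        by (subst power_mult_distrib[symmetric]) simp
      also have "\<dots> \<le> (1/2) ^ j * (1/2) ^ k"
        using jk by (intro mult_right_mono power_decreasing) auto
      finally have "(1/4 :: real) ^ k *\<^sub>R x (r k) \<le> ((1/2) ^ j * (1/2) ^ k) *\<^sub>R x (r k)"
        by (rule scaleR_right_mono[OF _ x])
      also have "\<dots> = (1/2) ^ j *\<^sub>R t k" by (simp add: t_def)
      also have "\<dots> \<le> (1/2) ^ j *\<^sub>R z" by (intro scaleR_left_mono tz) simp
      also have "\<dots> \<le> 4 ^ j *\<^sub>R v j + (1/2) ^ j *\<^sub>R z" using vz0(1)[of j] by simp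
      finally have "x (r j) - (4 ^ j *\<^sub>R v j + (1/2) ^ j *\<^sub>R z) \<le> x (r j) - (1/4) ^ k *\<^sub>R x (r k)"
        by (rule diff_left_mono)
      also have "\<dots> = (1/4) ^ k *\<^sub>R (4 ^ k *\<^sub>R x (r j) - x (r k))"
        by (simp only: scaleR_right_diff_distrib scaleR_scaleR power_mult_distrib[symmetric]) simp
      also have "\<dots> \<le> (1/4) ^ k *\<^sub>R sup (4 ^ k *\<^sub>R x (r j) - x (r k)) 0"
        by (intro scaleR_left_mono) auto
      finally show ?thesis unfolding y_def
        by (intro sup_least scaleR_nonneg_nonneg) auto
    qed
    have "inf ((1/4) ^ k *\<^sub>R sup (4 ^ k *\<^sub>R x (r j) - x (r k)) 0)
        (1 *\<^sub>R sup (x (r k) - 4 ^ k *\<^sub>R x (r j)) 0) = 0"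
      by (rule disjoint_scaleR[OF disjoint_sup_diff]) simp_all
    then show ?thesis
      unfolding scaleR_one by (rule disjoint_mono[OF _ y0 yj y0 yk])
  qed
  \<comment> \<open>Removing 2^-k z costs less than e / 4 only from some L on; the terms before it
    are dropped.\<close>
  have "(\<lambda>k. (1/2) ^ k * (C * norm z)) \<longlonglongrightarrow> 0 * (C * norm z)"
    by (intro tendsto_mult tendsto_const LIMSEQ_power_zero) simp
  then have "\<forall>\<^sub>F k in sequentially. (1/2) ^ k * (C * norm z) < e / 4"
    using e by (intro order_tendstoD(2)) auto
  then obtain L where L: "\<And>k. k \<ge> L \<Longrightarrow> (1/2) ^ k * (C * norm z) < e / 4"
    unfolding eventually_sequentially by blast
  have big: "e / 2 \<le> blinfun_apply (f (r k)) (y k)" if "k \<ge> L" for k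
  proof -
    have "blinfun_apply (f (r k)) z \<le> norm (f (r k)) * norm z"
      using norm_blinfun[of "f (r k)" z] by simp
    also have "\<dots> \<le> C * norm z" using C by (intro mult_right_mono) auto
    finally have "(1/2) ^ k * blinfun_apply (f (r k)) z \<le> (1/2) ^ k * (C * norm z)"
      by (intro mult_left_mono) auto
    then have "e / 2 \<le> blinfun_apply (f (r k)) (x (r k)) - 4 ^ k * blinfun_apply (f (r k)) (v k)
        - (1/2) ^ k * blinfun_apply (f (r k)) z"
      using L[OF that] v_small[of k] ge[of "r k"] by linarith
    also have "\<dots> = blinfun_apply (f (r k)) (x (r k) - (4 ^ k *\<^sub>R v k + (1/2) ^ k *\<^sub>R z))"
      by (simp add: blinfun.diff_right blinfun.add_right blinfun.scaleR_right)
    also have "\<dots> \<le> blinfun_apply (f (r k)) (y k)"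
      unfolding y_def by (intro dual_pos_mono[OF pos] sup_ge1)
    finally show ?thesis .
  qed
  show thesis
  proof (rule that[of "\<lambda>k. r (k + L)" "\<lambda>k. y (k + L)"]; (intro allI impI)?)
    show "strict_mono (\<lambda>k. r (k + L))"
      using r(1) by (intro strict_monoI_Suc) simp
    show "0 \<le> y (k + L)" for k by (rule y0)
    show "y (k + L) \<le> x (r (k + L))" for k by (rule yx)
    show "inf (y (j + L)) (y (k + L)) = 0" if "j \<noteq> k" for j k
    proof (cases "j < k")
      case False
      with that have "inf (y (k + L)) (y (j + L)) = 0" by (intro disj) simp
      then show ?thesis by (subst inf_commute)
    qed (intro disj, simp)
    show "e / 2 \<le> blinfun_apply (f (r (k + L))) (y (k + L))" for k
      by (rule big) simp
  qed
qed

lemma not_uniformly_nullE: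
  assumes "\<not> uniformly_null_on A f"
  obtains e r a where "0 < e" "strict_mono r" "\<forall>k. a k \<in> A"
    "\<forall>k::nat. e \<le> \<bar>blinfun_apply (f (r k)) (a k)\<bar>"
proof -
  obtain e where e: "0 < e" "\<not> (\<forall>\<^sub>F n in sequentially. \<forall>x\<in>A. \<bar>blinfun_apply (f n) x\<bar> < e)"
    using assms unfolding uniformly_null_on_def uniform_limit_iff by auto
  then have "\<not> (\<forall>\<^sub>F n in sequentially. \<not> (\<exists>x\<in>A. e \<le> \<bar>blinfun_apply (f n) x\<bar>))"
    by (simp add: not_le)
  then obtain r :: "nat \<Rightarrow> nat" where r: "strict_mono r" "\<forall>k. \<exists>x\<in>A. e \<le> \<bar>blinfun_apply (f (r k)) x\<bar>"
    by (rule infinite_subsequence)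
  have "\<exists>a. \<forall>k. a k \<in> A \<and> e \<le> \<bar>blinfun_apply (f (r k)) (a k)\<bar>"
    using r(2) unfolding Bex_def by (rule choice)
  then obtain a where "\<forall>k. a k \<in> A" "\<forall>k. e \<le> \<bar>blinfun_apply (f (r k)) (a k)\<bar>"
    unfolding all_conj_distrib by (elim exE conjE)
  then show thesis by (rule that[OF e(1) r(1)])
qed

text \<open>The majorant \<open>p\<close> is \<open>f\<close> itself when the functionals are
  positive, and the sequence of moduli when \<open>f\<close> is a disjoint L-sequence.\<close>

lemma not_uniformly_null_disjoint:
  fixes A :: "'a::banach_lattice set"
  assumes A: "bounded A" and pos: "\<And>n. dual_le 0 (p n)" and C: "\<And>n. norm (p n) \<le> C"
    and null: "\<And>y. 0 \<le> y \<Longrightarrow> (\<lambda>n. blinfun_apply (p n) y) \<longlonglongrightarrow> 0"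
    and fp: "\<And>n x. \<bar>blinfun_apply (f n) x\<bar> \<le> blinfun_apply (p n) \<bar>x\<bar>"
    and "\<not> uniformly_null_on A f"
  obtains e r y where "0 < e" "\<forall>k. 0 \<le> y k" "\<forall>j k. j \<noteq> k \<longrightarrow> inf (y j) (y k) = 0"
    "\<forall>k. y k \<in> solid_hull A" "\<forall>k::nat. e \<le> blinfun_apply (p (r k)) (y k)"
proof -
  obtain e s a where e: "0 < e" and s: "strict_mono s" and a: "\<forall>k. a k \<in> A"
    "\<forall>k::nat. e \<le> \<bar>blinfun_apply (f (s k)) (a k)\<bar>"
    by (rule not_uniformly_nullE[OF assms(6)])
  obtain B where B: "\<forall>x\<in>A. norm x \<le> B" using A unfolding bounded_iff ..
  have nB: "norm \<bar>a k\<bar> \<le> B" for k using B a(1) by (simp add: norm_abs_banach_lattice)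
  have ge: "e \<le> blinfun_apply (p (s k)) \<bar>a k\<bar>" for k
    using a(2)[rule_format] fp by (rule order_trans)
  have ns: "(\<lambda>n. blinfun_apply (p (s n)) y) \<longlonglongrightarrow> 0" if "0 \<le> y" for y
    using LIMSEQ_subseq_LIMSEQ[OF null[OF that] s] by (simp add: o_def)
  obtain r y where ry: "\<forall>k. 0 \<le> y k" "\<forall>k. y k \<le> \<bar>a (r k)\<bar>"
    "\<forall>j k. j \<noteq> k \<longrightarrow> inf (y j) (y k) = 0"
    "\<forall>k::nat. e / 2 \<le> blinfun_apply (p (s (r k))) (y k)"
    by (rule disjoint_sequence_below[where f = "\<lambda>n. p (s n)", OF pos C ns abs_ge_zero nB e ge])
  have y: "y k \<in> solid_hull A" for k
  proof -
    have "\<bar>y k\<bar> \<le> \<bar>a (r k)\<bar>" using ry(1,2) by (simp add: abs_of_nonneg_lattice)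
    then show ?thesis using a(1) unfolding solid_hull_def by blast
  qed
  show thesis
    by (rule that[OF _ ry(1,3), of "e / 2" "\<lambda>k. s (r k)"]) (use e y ry(4) in simp_all)
qed

section \<open>L-sequences tested on disjoint sequences\<close>

lemma disjointly_weakly_compact_weakly_null:
  assumes A: "disjointly_weakly_compact A" and y: "\<And>k. y k \<in> solid_hull A"
    "\<And>j k. j \<noteq> k \<Longrightarrow> inf (y j) (y k) = 0" and u: "\<And>k. \<bar>u k\<bar> \<le> y k"
  shows "weakly_null u"
proof -
  have "u k \<in> solid_hull A" for k
  proof -
    obtain a where a: "a \<in> A" "\<bar>y k\<bar> \<le> \<bar>a\<bar>" using y(1)[of k] unfolding solid_hull_def by blast
    have "\<bar>u k\<bar> \<le> \<bar>a\<bar>" using order_trans[OF u order_trans[OF abs_ge_self a(2)]] .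
    then show ?thesis using a(1) unfolding solid_hull_def by blast
  qed
  moreover have "disjoint_seq u"
    unfolding disjoint_seq_def using disjoint_mono[OF y(2) abs_ge_zero u abs_ge_zero u] by blast
  ultimately show ?thesis using A unfolding disjointly_weakly_compact_def by blast
qed

text \<open>Some u_k with |u_k| <= y_k nearly attains |f_(r k)|(y_k). As it depends on f_(r k) and
  may change sign, \<open>weak\<close> has to cover all sequences dominated by
  \<open>y\<close>.\<close>

lemma L_sequence_not_large_on_weakly_null:
  fixes f :: "nat \<Rightarrow> 'a::banach_lattice \<Rightarrow>\<^sub>L real"
  assumes f: "L_sequence f" and y: "\<And>k. 0 \<le> y k" and e: "0 < e"
    and ge: "\<And>k::nat. e \<le> blinfun_apply (dual_abs (f (r k))) (y k)"
    and weak: "\<And>u. (\<And>k. \<bar>u k\<bar> \<le> y k) \<Longrightarrow> weakly_null u"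
  shows False
proof -
  have "\<exists>u. \<bar>u\<bar> \<le> y k \<and> e / 2 \<le> blinfun_apply (f (r k)) u" for k
  proof -
    obtain u where "\<bar>u\<bar> \<le> y k" "blinfun_apply (dual_abs (f (r k))) (y k) - e / 2 < blinfun_apply (f (r k)) u"
      by (rule dual_abs_approx[OF y half_gt_zero[OF e]])
    then show ?thesis using ge[of k] by (intro exI[of _ u]) simp
  qed
  then obtain u where u: "\<And>k. \<bar>u k\<bar> \<le> y k" "\<And>k. e / 2 \<le> blinfun_apply (f (r k)) (u k)" by metis
  have "weakly_null u" using u(1) by (rule weak)
  then have "uniform_limit (range f) (\<lambda>n g. blinfun_apply g (u n)) (\<lambda>_. 0) sequentially"
    using f unfolding L_sequence_def L_set_def by blast
  from uniform_limitD[OF this half_gt_zero[OF e]]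
  obtain n where "\<forall>g\<in>range f. dist (blinfun_apply g (u n)) 0 < e / 2"
    by (auto dest: eventually_happens)
  then have "dist (blinfun_apply (f (r n)) (u n)) 0 < e / 2" by blast
  then show False using u(2)[of n] by simp
qed

lemma dual_disjoint_separated:
  "dual_disjoint_seq f \<Longrightarrow> n \<noteq> m \<Longrightarrow> separated (dual_abs (f n)) (dual_abs (f m))"
  unfolding dual_disjoint_seq_def by (simp add: separated_if_dual_inf_0 dual_abs_pos)

text \<open>Otherwise the selection yields disjoint w_k in [0, x] on which the moduli stay above e /
  2 along a subsequence. Whatever the w_k dominate is weakly null, which contradicts the
  L-property.\<close>

lemma disjoint_L_sequence_weak_star_null:
  fixes f :: "nat \<Rightarrow> 'a::banach_lattice \<Rightarrow>\<^sub>L real"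
  assumes disj: "dual_disjoint_seq f" and f: "L_sequence f" and x: "0 \<le> x"
  shows "(\<lambda>n. blinfun_apply (dual_abs (f n)) x) \<longlonglongrightarrow> 0"
proof (rule ccontr)
  assume "\<not> ?thesis"
  then obtain e where e: "0 < e"
    "\<not> (\<forall>\<^sub>F n in sequentially. \<bar>blinfun_apply (dual_abs (f n)) x\<bar> < e)"
    unfolding tendsto_iff by auto
  then have "\<not> (\<forall>\<^sub>F n in sequentially. \<not> (e \<le> blinfun_apply (dual_abs (f n)) x))"
    by (simp add: not_le dual_pos_nonneg[OF dual_abs_pos x])
  then obtain q :: "nat \<Rightarrow> nat" where q: "strict_mono q" "\<forall>k. e \<le> blinfun_apply (dual_abs (f (q k))) x"
    by (rule infinite_subsequence)
  obtain C where C: "\<And>n. norm (f n) \<le> C"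
    using f unfolding L_sequence_def L_set_def bounded_iff by auto
  have M: "blinfun_apply (dual_abs (f (q n))) x \<le> C * norm x" for n
    using norm_dual_abs_le[OF x, of "f (q n)"] mult_right_mono[OF C[of "q n"] norm_ge_zero[of x]] by linarith
  have sep: "separated (dual_abs (f (q n))) (dual_abs (f (q m)))" if "n \<noteq> m" for n m
    using that strict_mono_eq[OF q(1)] by (intro dual_disjoint_separated[OF disj]) simp
  obtain r w where rw': "\<forall>k. 0 \<le> w k" "\<forall>k. w k \<le> x" "\<forall>j k. j \<noteq> k \<longrightarrow> inf (w j) (w k) = 0"
    "\<forall>k::nat. blinfun_apply (dual_abs (f (q (r k)))) (x - w k) \<le> e / 2"
    by (rule separated_selection[of "\<lambda>n. dual_abs (f (q n))",
        OF dual_abs_pos sep x M half_gt_zero[OF e(1)]])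
  note rw = rw'[rule_format]
  show False
  proof (rule L_sequence_not_large_on_weakly_null[OF f rw(1) half_gt_zero[OF e(1)]])
    show "e / 2 \<le> blinfun_apply (dual_abs (f (q (r k)))) (w k)" for k
      using q(2)[rule_format, of "r k"] rw(4)[of k] unfolding blinfun.diff_right by linarith
    show "weakly_null u" if "\<And>k. \<bar>u k\<bar> \<le> w k" for u
      by (rule order_bounded_disjoint_weakly_null[OF that rw(2,3)])
  qed
qed

section \<open>Order bounded disjoint sequences are L-sequences\<close>

lemma dual_order_bounded_abs:
  assumes "dual_order_bounded_seq f"
  obtains k where "dual_le 0 k" "\<forall>n. dual_le (dual_abs (f n)) k"
proof -
  obtain g h where gh: "\<And>n. dual_le g (f n)" "\<And>n. dual_le (f n) h"
    using assms unfolding dual_order_bounded_seq_def by blast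
  have le: "blinfun_apply h x \<le> blinfun_apply (dual_abs h) x" "- blinfun_apply g x \<le> blinfun_apply (dual_abs g) x"
    "0 \<le> blinfun_apply (dual_abs g) x" "0 \<le> blinfun_apply (dual_abs h) x" if "0 \<le> x" for x
    using dual_abs_upper(1)[of h] dual_abs_upper(2)[of g] dual_abs_pos[of g] dual_abs_pos[of h] that
    unfolding dual_le_def by (simp_all add: blinfun.minus_left)
  show thesis
  proof (rule that[of "dual_abs g + dual_abs h"])
    show "dual_le 0 (dual_abs g + dual_abs h)"
      unfolding dual_le_def using le(3,4) by (simp add: blinfun.add_left)
    show "\<forall>n. dual_le (dual_abs (f n)) (dual_abs g + dual_abs h)"
    proof (intro allI; rule dual_abs_least; unfold dual_le_def; intro allI impI)
      fix n and x :: 'a assume x: "0 \<le> x"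
      have "blinfun_apply (f n) x \<le> blinfun_apply h x" "blinfun_apply g x \<le> blinfun_apply (f n) x"
        using gh[of n] x unfolding dual_le_def by simp_all
      then show "blinfun_apply (f n) x \<le> blinfun_apply (dual_abs g + dual_abs h) x"
        "blinfun_apply (- f n) x \<le> blinfun_apply (dual_abs g + dual_abs h) x"
        using le[OF x] unfolding blinfun.add_left blinfun.minus_left by linarith+
    qed
  qed
qed

lemma order_bounded_disjoint_L_sequence:
  fixes f :: "nat \<Rightarrow> 'a::banach_lattice \<Rightarrow>\<^sub>L real"
  assumes ob: "dual_order_bounded_seq f" and disj: "dual_disjoint_seq f"
  shows "L_sequence f"
proof -
  obtain k where k0: "dual_le 0 k" and k': "\<forall>n. dual_le (dual_abs (f n)) k"
    by (rule dual_order_bounded_abs[OF ob])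
  note k = k'[rule_format]
  have sum_le: "(\<Sum>i<n. \<bar>blinfun_apply (f i) x\<bar>) \<le> blinfun_apply k \<bar>x\<bar>" for n x
  proof -
    have "(\<Sum>i<n. \<bar>blinfun_apply (f i) x\<bar>) \<le> (\<Sum>i<n. blinfun_apply (dual_abs (f i)) \<bar>x\<bar>)"
      by (intro sum_mono abs_apply_le_dual_abs)
    also have "\<dots> \<le> blinfun_apply k \<bar>x\<bar>"
      by (intro separated_sum_le dual_abs_pos k k0 dual_disjoint_separated[OF disj]) auto
    finally show ?thesis .
  qed
  have sm: "summable (\<lambda>i. \<bar>blinfun_apply (f i) x\<bar>)" for x
    using sum_le by (rule summableI_nonneg_bounded[rotated]) simp
  have sum_le': "(\<Sum>i. \<bar>blinfun_apply (f i) x\<bar>) \<le> norm x * norm k" for x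
  proof -
    have "(\<Sum>i. \<bar>blinfun_apply (f i) x\<bar>) \<le> blinfun_apply k \<bar>x\<bar>"
      using sm sum_le by (rule suminf_le_const)
    also have "\<dots> \<le> norm x * norm k"
      using norm_blinfun[of k "\<bar>x\<bar>"] by (simp add: norm_abs_banach_lattice mult.commute)
    finally show ?thesis .
  qed
  \<comment> \<open>Each \<open>F K\<close> is a bounded functional, by the l1 bound above. Weak
    nullity tested on all \<open>F K\<close> is precisely the convergence over index sets that
    \<open>schur_uniform_convergence\<close> asks for.\<close>
  define F where "F K x = (\<Sum>i. if i \<in> K then blinfun_apply (f i) x else 0)" for K x
  have smK': "summable (\<lambda>i. \<bar>if i \<in> K then blinfun_apply (f i) x else 0\<bar>)" for K x
    by (rule summable_comparison_test'[OF sm[of x]]) simp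
  have smK: "summable (\<lambda>i. if i \<in> K then blinfun_apply (f i) x else 0)" for K x
    using smK' by (rule summable_rabs_cancel)
  have F: "bounded_linear (F K)" for K
  proof (rule bounded_linear_intro)
    show "F K (x + y) = F K x + F K y" for x y
      unfolding F_def suminf_add[OF smK smK] by (intro suminf_cong) (simp add: blinfun.add_right)
    show "F K (c *\<^sub>R x) = c *\<^sub>R F K x" for c x
      unfolding F_def real_scaleR_def suminf_mult[OF smK, symmetric]
      by (intro suminf_cong) (simp add: blinfun.scaleR_right)
    show "norm (F K x) \<le> norm x * norm k" for x
    proof -
      have "norm (F K x) \<le> (\<Sum>i. \<bar>if i \<in> K then blinfun_apply (f i) x else 0\<bar>)"
        unfolding F_def real_norm_def by (rule summable_rabs[OF smK'])
      also have "\<dots> \<le> (\<Sum>i. \<bar>blinfun_apply (f i) x\<bar>)"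
        by (rule suminf_le[OF _ smK' sm]) simp
      also have "\<dots> \<le> norm x * norm k" by (rule sum_le')
      finally show ?thesis .
    qed
  qed
  show ?thesis
    unfolding L_sequence_def L_set_def
  proof (intro conjI allI impI)
    show "bounded (range f)"
      unfolding bounded_iff using dual_le_norm_mono[OF dual_abs_pos k abs_apply_le_dual_abs] by blast
    fix x :: "nat \<Rightarrow> 'a" assume x: "weakly_null x"
    have "(\<lambda>n. F K (x n)) \<longlonglongrightarrow> 0" for K
      using x[unfolded weakly_null_iff, rule_format, of "Blinfun (F K)"]
      by (simp add: bounded_linear_Blinfun_apply[OF F])
    then have "\<forall>\<^sub>F n in sequentially. \<forall>i. \<bar>blinfun_apply (f i) (x n)\<bar> < e" if "0 < e" for e
      using that unfolding F_def by (intro schur_uniform_convergence sm)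
    then show "uniform_limit (range f) (\<lambda>n g. blinfun_apply g (x n)) (\<lambda>_. 0) sequentially"
      unfolding uniform_limit_iff by simp
  qed
qed

section \<open>Components of a positive functional and the counterexample to (2) and (4)\<close>

text \<open>Here h(x) is the supremum of g over the elements of [0, x] in the ideal generated by w.
  The last two conclusions express that w carries h: it vanishes off w, and its value at x is nearly
  reached inside the ideal. Together they make the components on disjoint elements disjoint.\<close>

lemma carrier_functional:
  fixes g :: "'a::banach_lattice \<Rightarrow>\<^sub>L real"
  assumes g: "dual_le 0 g" and w: "0 \<le> w"
  obtains h where "dual_le 0 h" "dual_le h g" "blinfun_apply g w \<le> blinfun_apply h w"
    "\<forall>y\<ge>0. inf w y = 0 \<longrightarrow> blinfun_apply h y = 0"
    "\<forall>x\<ge>0. \<forall>e>0. \<exists>u c. 0 \<le> c \<and> 0 \<le> u \<and> u \<le> c *\<^sub>R w \<and> u \<le> x \<and> blinfun_apply h (x - u) < e"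
proof -
  \<comment> \<open>Only an upper bound is imposed: the suprema are taken over positive elements,
    and the positive part of \<open>I\<close> is that of the ideal generated by
    \<open>w\<close>.\<close>
  define I where "I = {y. \<exists>c\<ge>0. y \<le> c *\<^sub>R w}"
  obtain h where h: "\<And>x y. y \<in> I \<Longrightarrow> 0 \<le> y \<Longrightarrow> y \<le> x \<Longrightarrow> blinfun_apply g y \<le> blinfun_apply h x"
    "\<And>x c. 0 \<le> x \<Longrightarrow> (\<And>y. y \<in> I \<Longrightarrow> 0 \<le> y \<Longrightarrow> y \<le> x \<Longrightarrow> blinfun_apply g y \<le> c) \<Longrightarrow> blinfun_apply h x \<le> c"
  proof (rule riesz_kantorovich_on_ideal[of I g])
    show "0 \<in> I" unfolding I_def by auto
    show "x + y \<in> I" if xy: "x \<in> I" "y \<in> I" for x y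
    proof -
      obtain c d where "0 \<le> c" "x \<le> c *\<^sub>R w" "0 \<le> d" "y \<le> d *\<^sub>R w" using xy unfolding I_def by blast
      then have "0 \<le> c + d" "x + y \<le> (c + d) *\<^sub>R w" by (simp_all add: scaleR_left_distrib add_mono)
      then show ?thesis unfolding I_def by blast
    qed
    show "c *\<^sub>R x \<in> I" if c: "0 < c" "x \<in> I" for c x
    proof -
      obtain d where d: "0 \<le> d" "x \<le> d *\<^sub>R w" using c unfolding I_def by blast
      have "c *\<^sub>R x \<le> c *\<^sub>R (d *\<^sub>R w)" using c d by (intro scaleR_left_mono) auto
      then have "c *\<^sub>R x \<le> (c * d) *\<^sub>R w" "0 \<le> c * d" using c d by simp_all
      then show ?thesis unfolding I_def by blast
    qed
    show "x \<in> I" if "0 \<le> x" "x \<le> y" "y \<in> I" for x y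
      using that(3) order_trans[OF that(2)] unfolding I_def by blast
  qed auto
  have "w \<in> I" unfolding I_def by (auto intro: exI[of _ 1])
  show thesis
  proof (rule that[of h]; (intro allI impI)?)
    show "dual_le 0 h"
      using h(1)[of 0] by (simp add: dual_le_def blinfun.zero_right I_def exI[of _ 0])
    show "dual_le h g"
      unfolding dual_le_def using h(2) dual_pos_mono[OF g] by simp
    show "blinfun_apply g w \<le> blinfun_apply h w"
      by (rule h(1)[OF \<open>w \<in> I\<close> w order_refl])
    show "blinfun_apply h y = 0" if y: "0 \<le> y" "inf w y = 0" for y
    proof (rule order.antisym)
      show "0 \<le> blinfun_apply h y" using \<open>dual_le 0 h\<close> y(1) by (rule dual_pos_nonneg)
      show "blinfun_apply h y \<le> 0"
      proof (rule h(2)[OF y(1)])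
        fix u assume u: "u \<in> I" "0 \<le> u" "u \<le> y"
        then obtain c where c: "0 \<le> c" "u \<le> c *\<^sub>R w" unfolding I_def by blast
        have "inf (c *\<^sub>R w) (1 *\<^sub>R y) = 0" using y(2) c(1) by (rule disjoint_scaleR) simp
        then have "inf u u = 0" using disjoint_mono[of "c *\<^sub>R w" y u u] u c by simp
        then show "blinfun_apply g u \<le> 0" by (simp add: blinfun.zero_right)
      qed
    qed
    show "\<exists>u c. 0 \<le> c \<and> 0 \<le> u \<and> u \<le> c *\<^sub>R w \<and> u \<le> x \<and> blinfun_apply h (x - u) < e"
      if x: "0 \<le> x" and e: "0 < e" for x e
    proof -
      have "\<exists>u\<in>I. 0 \<le> u \<and> u \<le> x \<and> blinfun_apply h x - e < blinfun_apply g u"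
      proof (rule ccontr)
        assume "\<not> ?thesis"
        then have "blinfun_apply h x \<le> blinfun_apply h x - e"
          using x by (intro h(2)) (auto simp: not_less)
        then show False using e by simp
      qed
      then obtain u where u: "u \<in> I" "0 \<le> u" "u \<le> x" "blinfun_apply h x - e < blinfun_apply g u" by blast
      have "blinfun_apply h (x - u) < e"
        using u(4) h(1)[OF u(1,2) order_refl] by (simp add: blinfun.diff_right)
      moreover obtain c where "0 \<le> c" "u \<le> c *\<^sub>R w" using u(1) unfolding I_def by blast
      ultimately show ?thesis using u(2,3) by blast
    qed
  qed
qed

lemma carriers_disjoint:
  fixes g :: "'a::banach_lattice \<Rightarrow>\<^sub>L real" and w :: "nat \<Rightarrow> 'a"
  assumes g: "dual_le 0 g" and w: "\<And>n. 0 \<le> w n" and disj: "\<And>n m. n \<noteq> m \<Longrightarrow> inf (w n) (w m) = 0"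
  obtains h where "\<forall>n. dual_le 0 (h n)" "\<forall>n. dual_le (h n) g" "dual_disjoint_seq h"
    "\<forall>n. blinfun_apply g (w n) \<le> blinfun_apply (h n) (w n)"
    "\<forall>n. \<forall>y\<ge>0. inf (w n) y = 0 \<longrightarrow> blinfun_apply (h n) y = 0"
proof -
  define H where "H n h \<longleftrightarrow> dual_le 0 h \<and> dual_le h g \<and> blinfun_apply g (w n) \<le> blinfun_apply h (w n) \<and>
    (\<forall>y\<ge>0. inf (w n) y = 0 \<longrightarrow> blinfun_apply h y = 0) \<and>
    (\<forall>x\<ge>0. \<forall>e>0. \<exists>u c. 0 \<le> c \<and> 0 \<le> u \<and> u \<le> c *\<^sub>R w n \<and> u \<le> x \<and> blinfun_apply h (x - u) < e)"
    for n h
  have exH: "\<exists>h. H n h" for n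
  proof -
    obtain h where "dual_le 0 h" "dual_le h g" "blinfun_apply g (w n) \<le> blinfun_apply h (w n)"
      "\<forall>y\<ge>0. inf (w n) y = 0 \<longrightarrow> blinfun_apply h y = 0"
      "\<forall>x\<ge>0. \<forall>e>0. \<exists>u c. 0 \<le> c \<and> 0 \<le> u \<and> u \<le> c *\<^sub>R w n \<and> u \<le> x \<and> blinfun_apply h (x - u) < e"
      by (rule carrier_functional[OF g w])
    then have "H n h" unfolding H_def by (intro conjI)
    then show ?thesis ..
  qed
  define h where "h n = (SOME h. H n h)" for n
  have H: "H n (h n)" for n unfolding h_def by (rule someI_ex[OF exH])
  have h0: "dual_le 0 (h n)" and hg: "dual_le (h n) g"
    and hw: "blinfun_apply g (w n) \<le> blinfun_apply (h n) (w n)"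
    and hz: "\<forall>y\<ge>0. inf (w n) y = 0 \<longrightarrow> blinfun_apply (h n) y = 0"
    and ha: "\<forall>x\<ge>0. \<forall>e>0. \<exists>u c. 0 \<le> c \<and> 0 \<le> u \<and> u \<le> c *\<^sub>R w n \<and> u \<le> x \<and>
      blinfun_apply (h n) (x - u) < e" for n
    using H[of n] unfolding H_def by simp_all
  have "dual_inf (h n) (h m) = 0" if nm: "n \<noteq> m" for n m
  proof (rule dual_inf_eqI[OF h0 h0])
    fix k assume k: "dual_le k (h n)" "dual_le k (h m)"
    show "dual_le k 0"
      unfolding dual_le_def
    proof (intro allI impI)
      fix x :: 'a assume x: "0 \<le> x"
      \<comment> \<open>Split x into u, which lies in the ideal of \<open>w n\<close> where
        \<open>h m\<close> vanishes, and x - u, where \<open>h n\<close> is below e; a functional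
        below both is then below e at x.\<close>
      have "blinfun_apply k x \<le> 0 + e" if e: "0 < e" for e
      proof -
        obtain u c where c: "0 \<le> c" and u: "0 \<le> u" "u \<le> c *\<^sub>R w n" "u \<le> x"
          "blinfun_apply (h n) (x - u) < e"
          using ha[of n] x e by blast
        have "inf (1 *\<^sub>R w m) (c *\<^sub>R w n) = 0"
          using disj[OF nm[symmetric]] c by (intro disjoint_scaleR) auto
        then have "inf (w m) u = 0"
          unfolding scaleR_one by (rule disjoint_mono[OF _ w order_refl u(1,2)])
        then have "blinfun_apply (h m) u = 0" using hz[of m] u(1) by blast
        moreover have "blinfun_apply k u \<le> blinfun_apply (h m) u"
          using k(2) u(1) unfolding dual_le_def by simp
        moreover have "blinfun_apply k (x - u) \<le> blinfun_apply (h n) (x - u)"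
          using k(1) u(3) unfolding dual_le_def by simp
        ultimately show ?thesis using u(4) unfolding blinfun.diff_right by linarith
      qed
      then show "blinfun_apply k x \<le> blinfun_apply 0 x" by (simp add: field_le_epsilon)
    qed
  qed
  then have disj_h: "dual_disjoint_seq h"
    unfolding dual_disjoint_seq_def using dual_abs_of_pos[OF h0] by simp
  show thesis
    by (rule that[OF allI[OF h0] allI[OF hg] disj_h allI[OF hw] allI[OF hz]])
qed

text \<open>The values h_n(|x|) are summable with sum at most g(|x|), so they tend to 0.\<close>

lemma order_bounded_disjoint_weak_star_null:
  fixes h :: "nat \<Rightarrow> 'a::banach_lattice \<Rightarrow>\<^sub>L real"
  assumes h0: "\<And>n. dual_le 0 (h n)" and hg: "\<And>n. dual_le (h n) g" and disj: "dual_disjoint_seq h"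
  shows "weak_star_null h"
  unfolding weak_star_null_iff
proof
  fix x :: 'a
  have sep: "separated (h n) (h m)" if "n \<noteq> m" for n m
    using dual_disjoint_separated[OF disj that] unfolding dual_abs_of_pos[OF h0] .
  have g0: "dual_le 0 g" using h0 hg by (rule dual_le_trans)
  have "summable (\<lambda>n. blinfun_apply (h n) \<bar>x\<bar>)"
  proof (rule summableI_nonneg_bounded)
    show "0 \<le> blinfun_apply (h n) \<bar>x\<bar>" for n by (rule dual_pos_nonneg[OF h0 abs_ge_zero])
    show "(\<Sum>i<n. blinfun_apply (h i) \<bar>x\<bar>) \<le> blinfun_apply g \<bar>x\<bar>" for n
      by (intro separated_sum_le h0 hg g0 sep) auto
  qed
  then have "(\<lambda>n. blinfun_apply (h n) \<bar>x\<bar>) \<longlonglongrightarrow> 0" by (rule summable_LIMSEQ_zero)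
  moreover have "\<forall>n. norm (blinfun_apply (h n) x) \<le> blinfun_apply (h n) \<bar>x\<bar>"
    unfolding real_norm_def by (intro allI abs_apply_pos_le h0)
  ultimately show "(\<lambda>n. blinfun_apply (h n) x) \<longlonglongrightarrow> 0"
    by (rule Lim_null_comparison[OF always_eventually, rotated])
qed

text \<open>One sequence refutes (2) and (4) together, being positive, order bounded, disjoint and
  weak* null at once.\<close>

lemma not_disjointly_weakly_compactE:
  fixes A :: "'a::banach_lattice set"
  assumes "bounded A" "\<not> disjointly_weakly_compact A"
  obtains h where "range h \<subseteq> dual_positive_cone" "dual_order_bounded_seq h"
    "dual_disjoint_seq h" "weak_star_null h" "\<not> uniformly_null_on A h"
proof -
  obtain x where x: "range x \<subseteq> solid_hull A" "disjoint_seq x" "\<not> weakly_null x"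
    using assms unfolding disjointly_weakly_compact_def by blast
  obtain f :: "'a \<Rightarrow>\<^sub>L real" where "\<not> (\<lambda>n. blinfun_apply f (x n)) \<longlonglongrightarrow> 0"
    using x(3) unfolding weakly_null_iff by blast
  then obtain e where e: "0 < e" "\<not> (\<forall>\<^sub>F n in sequentially. \<bar>blinfun_apply f (x n)\<bar> < e)"
    unfolding tendsto_iff by auto
  then have "\<not> (\<forall>\<^sub>F n in sequentially. \<not> (e \<le> \<bar>blinfun_apply f (x n)\<bar>))"
    by (simp add: not_le)
  then obtain q :: "nat \<Rightarrow> nat" where q: "strict_mono q" "\<forall>k. e \<le> \<bar>blinfun_apply f (x (q k))\<bar>"
    by (rule infinite_subsequence)
  define g where "g = dual_abs f"
  have g0: "dual_le 0 g" unfolding g_def by (rule dual_abs_pos)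
  \<comment> \<open>An element X <= |a| = a^+ + a^- is the sum of inf X a^+ and a piece below a^-;
    one of the two keeps half of g(X).\<close>
  define R where "R k aw \<longleftrightarrow> fst aw \<in> A \<and> 0 \<le> snd aw \<and> snd aw \<le> \<bar>x (q k)\<bar> \<and> e / 2 \<le> blinfun_apply g (snd aw) \<and>
    (snd aw \<le> sup (fst aw) 0 \<or> snd aw \<le> sup (- fst aw) 0)" for k aw
  have "\<exists>aw. R k aw" for k
  proof -
    define X where "X = \<bar>x (q k)\<bar>"
    have X0: "0 \<le> X" unfolding X_def by simp
    obtain a where a: "a \<in> A" "X \<le> \<bar>a\<bar>" using x(1) unfolding solid_hull_def X_def by blast
    have "X \<le> inf X (sup a 0) + sup (- a) 0"
    proof -
      have "X \<le> inf (X + sup (- a) 0) (sup a 0 + sup (- a) 0)"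
        using a(2) X0 unfolding abs_eq_pos_parts[of a] by (intro inf_greatest) simp_all
      then show ?thesis unfolding add_inf_distrib_right .
    qed
    then have "X - inf X (sup a 0) \<le> sup (- a) 0" by (simp only: diff_le_eq add.commute)
    moreover have "X - inf X (sup a 0) \<le> X" "0 \<le> X - inf X (sup a 0)"
      using X0 inf_greatest[OF X0 sup_ge2[of 0 a]] by (simp_all only: diff_le_eq le_diff_eq le_add_same_cancel1 add_0 inf_le1)
    moreover have "e \<le> blinfun_apply g X"
      using q(2)[rule_format, of k] abs_apply_le_dual_abs[of f "x (q k)"] unfolding g_def X_def by linarith
    then have "e / 2 \<le> blinfun_apply g (inf X (sup a 0)) \<or> e / 2 \<le> blinfun_apply g (X - inf X (sup a 0))"
      unfolding blinfun.diff_right by linarith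
    moreover have "0 \<le> inf X (sup a 0)" using X0 by simp
    ultimately have "R k (a, inf X (sup a 0)) \<or> R k (a, X - inf X (sup a 0))"
      using a(1) unfolding R_def X_def[symmetric] by auto
    then show ?thesis by blast
  qed
  then have someR: "R k (SOME aw. R k aw)" for k by (rule someI_ex)
  define a where "a k = fst (SOME aw. R k aw)" for k
  define w where "w k = snd (SOME aw. R k aw)" for k
  have a: "a k \<in> A" and w: "0 \<le> w k" "w k \<le> \<bar>x (q k)\<bar>" and gw: "e / 2 \<le> blinfun_apply g (w k)"
    and wa: "w k \<le> sup (a k) 0 \<or> w k \<le> sup (- a k) 0" for k
    using someR[of k] unfolding R_def a_def w_def by simp_all
  have disj: "inf (w j) (w k) = 0" if "j \<noteq> k" for j k
  proof (rule disjoint_mono[OF _ w w])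
    show "inf \<bar>x (q j)\<bar> \<bar>x (q k)\<bar> = 0"
      using x(2) that strict_mono_eq[OF q(1)] unfolding disjoint_seq_def by simp
  qed
  obtain h where h: "\<forall>n. dual_le 0 (h n)" "\<forall>n. dual_le (h n) g" "dual_disjoint_seq h"
    "\<forall>n. blinfun_apply g (w n) \<le> blinfun_apply (h n) (w n)"
    "\<forall>n. \<forall>y\<ge>0. inf (w n) y = 0 \<longrightarrow> blinfun_apply (h n) y = 0"
    by (rule carriers_disjoint[OF g0 w(1) disj])
  \<comment> \<open>\<open>w k\<close> lies below one of the two disjoint parts of
    \<open>a k\<close>, so \<open>h k\<close> vanishes on the other part and no cancellation can
    occur at \<open>a k\<close>.\<close>
  have big: "e / 2 \<le> \<bar>blinfun_apply (h k) (a k)\<bar>" for k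
  proof -
    have hw: "e / 2 \<le> blinfun_apply (h k) s" if "w k \<le> s" for s
      using gw[of k] h(4)[rule_format, of k] dual_pos_mono[OF h(1)[rule_format] that, of k] by linarith
    have hz: "blinfun_apply (h k) t = 0" if "w k \<le> s" "inf s t = 0" "0 \<le> t" for s t
      using h(5) that(3) disjoint_mono[OF that(2) w(1) that(1,3) order_refl] by blast
    have ha: "blinfun_apply (h k) (a k) = blinfun_apply (h k) (sup (a k) 0) - blinfun_apply (h k) (sup (- a k) 0)"
      using arg_cong[OF banach_lattice_split[of "a k"], of "blinfun_apply (h k)"]
      by (simp only: blinfun.diff_right)
    have dis: "inf (sup (a k) 0) (sup (- a k) 0) = 0"
      using disjoint_sup_diff[of "a k" 0] by (simp only: diff_0_right diff_0)
    from wa[of k] show ?thesis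
    proof
      assume s: "w k \<le> sup (a k) 0"
      show ?thesis using hw[OF s] hz[OF s dis sup_ge2] ha by linarith
    next
      assume s: "w k \<le> sup (- a k) 0"
      have "inf (sup (- a k) 0) (sup (a k) 0) = 0" using dis by (subst inf_commute)
      then show ?thesis using hw[OF s] hz[OF s _ sup_ge2] ha by fastforce
    qed
  qed
  show thesis
  proof (rule that[of h])
    show "range h \<subseteq> dual_positive_cone" unfolding dual_positive_cone_def using h(1) by blast
    show "dual_order_bounded_seq h" unfolding dual_order_bounded_seq_def using h(1,2) by blast
    show "dual_disjoint_seq h" by (rule h)
    show "weak_star_null h"
      by (rule order_bounded_disjoint_weak_star_null[OF h(1,2)[rule_format] h(3)])
    show "\<not> uniformly_null_on A h"
    proof
      assume "uniformly_null_on A h"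
      then have "\<forall>\<^sub>F n in sequentially. \<forall>y\<in>A. dist (blinfun_apply (h n) y) 0 < e / 2"
        unfolding uniformly_null_on_def by (rule uniform_limitD) (simp add: e)
      then obtain n where "\<forall>y\<in>A. dist (blinfun_apply (h n) y) 0 < e / 2"
        by (auto dest: eventually_happens)
      then have "dist (blinfun_apply (h n) (a n)) 0 < e / 2" using a by blast
      then show False using big[of n] by simp
    qed
  qed
qed

section \<open>From disjoint weak compactness to uniform convergence, and the equivalence\<close>

text \<open>The common upper bound g replaces the varying functionals by a fixed one: e <= f_(r
  k)(y_k) <= g(y_k), although y is weakly null.\<close>

lemma disjointly_weakly_compact_order_bounded:
  fixes A :: "'a::banach_lattice set"
  assumes A: "bounded A" "disjointly_weakly_compact A"
    and f: "range f \<subseteq> dual_positive_cone" "dual_order_bounded_seq f" "weak_star_null f"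
  shows "uniformly_null_on A f"
proof (rule ccontr)
  assume neg: "\<not> uniformly_null_on A f"
  have pos: "dual_le 0 (f n)" for n using f(1) unfolding dual_positive_cone_def by blast
  obtain g where g: "\<forall>n. dual_le (f n) g" using f(2) unfolding dual_order_bounded_seq_def by blast
  have C: "norm (f n) \<le> norm g" for n
    by (rule dual_le_norm_mono[OF pos g[rule_format] abs_apply_pos_le[OF pos]])
  have null: "(\<lambda>n. blinfun_apply (f n) y) \<longlonglongrightarrow> 0" for y
    using f(3) unfolding weak_star_null_iff by blast
  obtain e r y where e: "0 < e" and y: "\<forall>k. 0 \<le> y k" "\<forall>j k. j \<noteq> k \<longrightarrow> inf (y j) (y k) = 0"
    "\<forall>k. y k \<in> solid_hull A" "\<forall>k::nat. e \<le> blinfun_apply (f (r k)) (y k)"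
    by (rule not_uniformly_null_disjoint[OF A(1) pos C null abs_apply_pos_le[OF pos] neg])
  have abs_y: "\<bar>y k\<bar> \<le> y k" for k
    unfolding abs_of_nonneg_lattice[OF y(1)[rule_format]] by (rule order_refl)
  have "weakly_null y"
    by (rule disjointly_weakly_compact_weakly_null[OF A(2) y(3)[rule_format] y(2)[rule_format] abs_y])
  then have "(\<lambda>k. blinfun_apply g (y k)) \<longlonglongrightarrow> 0" unfolding weakly_null_iff by blast
  moreover have "\<exists>N. \<forall>k\<ge>N. e \<le> blinfun_apply g (y k)"
  proof (intro exI allI impI)
    fix k
    show "e \<le> blinfun_apply g (y k)"
      using y(4)[rule_format, of k] g[rule_format, of "r k", unfolded dual_le_def, rule_format, OF y(1)[rule_format]]
      by (rule order_trans)
  qed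
  ultimately have "e \<le> 0" by (rule LIMSEQ_le_const)
  then show False using e by simp
qed

text \<open>No common upper bound is available here; the L-property replaces it, because every
  sequence dominated by the disjoint elements is weakly null too.\<close>

lemma disjointly_weakly_compact_L_sequence:
  fixes A :: "'a::banach_lattice set"
  assumes A: "bounded A" "disjointly_weakly_compact A"
    and f: "dual_disjoint_seq f" "L_sequence f"
  shows "uniformly_null_on A f"
proof (rule ccontr)
  assume neg: "\<not> uniformly_null_on A f"
  obtain C where "\<forall>n. norm (f n) \<le> C"
    using f(2) unfolding L_sequence_def L_set_def bounded_iff by auto
  then have C: "norm (dual_abs (f n)) \<le> C" for n
    using norm_dual_abs[of "f n"] by (meson order_trans)
  obtain e r y where e: "0 < e" and y: "\<forall>k. 0 \<le> y k" "\<forall>j k. j \<noteq> k \<longrightarrow> inf (y j) (y k) = 0"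
    "\<forall>k. y k \<in> solid_hull A" "\<forall>k::nat. e \<le> blinfun_apply (dual_abs (f (r k))) (y k)"
    by (rule not_uniformly_null_disjoint[OF A(1) dual_abs_pos C
        disjoint_L_sequence_weak_star_null[OF f] abs_apply_le_dual_abs neg])
  show False
  proof (rule L_sequence_not_large_on_weakly_null[OF f(2) y(1)[rule_format] e y(4)[rule_format]])
    show "weakly_null u" if "\<And>k. \<bar>u k\<bar> \<le> y k" for u
      by (rule disjointly_weakly_compact_weakly_null[OF A(2) y(3)[rule_format] y(2)[rule_format] that])
  qed
qed

theorem theorem2p3:
  fixes A :: "'a::banach_lattice set"
  assumes "bounded A"
  defines "S1 \<equiv> disjointly_weakly_compact A"
    and "S2 \<equiv> (\<forall>f :: nat \<Rightarrow> 'a \<Rightarrow>\<^sub>L real.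
      range f \<subseteq> dual_positive_cone \<and> dual_order_bounded_seq f \<and> weak_star_null f
        \<longrightarrow> uniformly_null_on A f)"
    and "S3 \<equiv> (\<forall>f :: nat \<Rightarrow> 'a \<Rightarrow>\<^sub>L real.
      dual_disjoint_seq f \<and> L_sequence f \<longrightarrow> uniformly_null_on A f)"
    and "S4 \<equiv> (\<forall>f :: nat \<Rightarrow> 'a \<Rightarrow>\<^sub>L real.
      dual_order_bounded_seq f \<and> dual_disjoint_seq f \<longrightarrow> uniformly_null_on A f)"
  shows "(S1 \<longleftrightarrow> S2) \<and> (S2 \<longleftrightarrow> S3) \<and> (S3 \<longleftrightarrow> S4)"
proof -
  have "S1 \<Longrightarrow> S2"
    unfolding S1_def S2_def using disjointly_weakly_compact_order_bounded[OF assms(1)] by blast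
  moreover have "S2 \<Longrightarrow> S1" "S4 \<Longrightarrow> S1"
    unfolding S1_def S2_def S4_def using not_disjointly_weakly_compactE[OF assms(1)] by metis+
  moreover have "S1 \<Longrightarrow> S3"
    unfolding S1_def S3_def using disjointly_weakly_compact_L_sequence[OF assms(1)] by blast
  moreover have "S3 \<Longrightarrow> S4"
    unfolding S3_def S4_def using order_bounded_disjoint_L_sequence by blast
  ultimately show ?thesis by blast
qed

end
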